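(* Let $k\geq 1$ be an integer, let $\lambda=\frac{1}{120k^2}$, and let $n\geq \frac{16(2k-1)}{\lambda^{2}}$ be an integer. Assume that $G$ is a graph of order $n$ which contains no $k$ independent cycles. Then $$\rho(G)\leq \rho(S_{n,2k-1}),$$ and equality holds if and only if $G\cong S_{n,2k-1}$.
   Context: Graphs are finite, simple and undirected. A set of cycles of a graph is called independent if no two of them have a common vertex; a graph "contains no $k$ independent cycles" if it has no $k$ pairwise vertex-disjoint cycles as subgraphs. For a graph $G$, $\rho(G)$ denotes its spectral radius, i.e. the largest eigenvalue of its adjacency matrix $A(G)$. For $n>2k-1$, $S_{n,2k-1}$ is the complete split graph: the join of a clique on $2k-1$ vertices with an independent set of $n-2k+1$ vertices. *)

theory Defs
  imports
    Complex_Main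
    "HOL-Combinatorics.Permutations"
    "Graph_Theory.Pair_Digraph"
    "Graph_Theory.Digraph_Isomorphism"
    "Jordan_Normal_Form.Spectral_Radius"
begin

text \<open>
  A finite simple undirected graph is a \<^locale>\<open>pair_graph\<close>: a finite vertex set with a
  symmetric, irreflexive arc relation, each undirected edge being represented by its two arcs.
\<close>

section \<open>Independent cycles\<close>

text \<open>
  In a symmetric digraph the closed walk \<open>u, v, u\<close> along a single edge counts as a
  \<^const>\<open>pre_digraph.cycle\<close>; requiring length at least 3 leaves exactly the (rooted and oriented)
  cycles of the undirected graph.
\<close>

definition undirected_cycle :: "'a pair_pre_digraph \<Rightarrow> ('a \<times> 'a) awalk \<Rightarrow> bool" where
  "undirected_cycle G p \<longleftrightarrow> pre_digraph.cycle (with_proj G) p \<and> 3 \<le> length p"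

definition cycle_verts :: "('a \<times> 'a) awalk \<Rightarrow> 'a set" where
  "cycle_verts p = fst ` set p"

text \<open>
  Walks that run through the same cycle with different root or orientation share vertices, so
  the members of an independent set are pairwise different also as subgraphs.
\<close>

definition independent_cycles :: "'a pair_pre_digraph \<Rightarrow> ('a \<times> 'a) awalk set \<Rightarrow> bool" where
  "independent_cycles G C \<longleftrightarrow>
     (\<forall>p\<in>C. undirected_cycle G p) \<and>
     pairwise (\<lambda>p q. disjnt (cycle_verts p) (cycle_verts q)) C"

definition contains_independent_cycles :: "nat \<Rightarrow> 'a pair_pre_digraph \<Rightarrow> bool" where
  "contains_independent_cycles k G \<longleftrightarrow>
     (\<exists>C. finite C \<and> card C = k \<and> independent_cycles G C)"

section \<open>Spectral radius\<close>

definition adjacency_matrix_wrt :: "'a list \<Rightarrow> 'a pair_pre_digraph \<Rightarrow> real mat" where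
  "adjacency_matrix_wrt vs G =
     mat (length vs) (length vs) (\<lambda>(i, j). if (vs ! i, vs ! j) \<in> parcs G then 1 else 0)"

definition adjacency_matrix :: "'a pair_pre_digraph \<Rightarrow> real mat" where
  "adjacency_matrix G =
     adjacency_matrix_wrt (SOME vs. distinct vs \<and> set vs = pverts G) G"

text \<open>
  The adjacency matrix of a nonempty finite simple graph is real symmetric, so that the set of
  its real eigenvalues is finite and nonempty and contains all its eigenvalues.
\<close>

definition graph_spectral_radius :: "'a pair_pre_digraph \<Rightarrow> real" where
  "graph_spectral_radius G = Max (spectrum (adjacency_matrix G))"

text \<open>The chosen enumeration of the vertices is irrelevant for the spectrum.\<close>

lemma eigenvalue_adjacency_matrix_wrt:
  assumes vs: "distinct vs" and ws: "distinct ws" and eq: "set vs = set ws"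
    and ev: "eigenvalue (adjacency_matrix_wrt vs G) e"
  shows "eigenvalue (adjacency_matrix_wrt ws G) e"
proof -
  define n where "n = length vs"
  have "mset ws = mset vs" using vs ws eq set_eq_iff_mset_eq_distinct by metis
  then obtain f where f: "f permutes {..<n}" and wsf: "permute_list f vs = ws"
    unfolding n_def by (rule mset_eq_permutation)
  have len: "length ws = n" using wsf n_def by auto
  have nth: "ws ! i = vs ! f i" if "i < n" for i
    using f wsf that permute_list_nth[of f vs i] n_def by simp
  have fn: "f i < n" if "i < n" for i
    using permutes_in_image[OF f, of i] that by simp
  let ?A = "adjacency_matrix_wrt vs G" and ?B = "adjacency_matrix_wrt ws G"
  from ev obtain v where v: "v \<in> carrier_vec n" "v \<noteq> 0\<^sub>v n" "?A *\<^sub>v v = e \<cdot>\<^sub>v v"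
    by (auto simp: eigenvalue_def eigenvector_def adjacency_matrix_wrt_def n_def)
  define w where "w = vec n (\<lambda>i. v $ f i)"
  have w: "w \<in> carrier_vec n" by (simp add: w_def)
  have "w \<noteq> 0\<^sub>v n"
  proof
    assume w0: "w = 0\<^sub>v n"
    have "v $ i = 0" if "i < n" for i
    proof -
      from f that obtain j where j: "j < n" "f j = i"
        by (metis lessThan_iff permutes_in_image permutes_surj surj_def)
      have "w $ j = 0" using w0 j by simp
      then show ?thesis using j by (simp add: w_def)
    qed
    then have "v = 0\<^sub>v n" using v(1) by auto
    with v(2) show False by simp
  qed
  moreover have "?B *\<^sub>v w = e \<cdot>\<^sub>v w"
  proof (rule eq_vecI)
    fix i assume "i < dim_vec (e \<cdot>\<^sub>v w)"
    then have i: "i < n" by (simp add: w_def)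
    let ?a = "\<lambda>x y. if (vs ! x, vs ! y) \<in> parcs G then 1 else (0::real)"
    have "(?B *\<^sub>v w) $ i = (\<Sum>j<n. ?a (f i) (f j) * v $ f j)"
      using i by (auto simp: adjacency_matrix_wrt_def len scalar_prod_def w_def nth
          atLeast0LessThan intro!: sum.cong)
    also have "\<dots> = (\<Sum>j<n. ?a (f i) j * v $ j)"
      by (rule sum.permute[OF f, of "\<lambda>j. ?a (f i) j * v $ j", symmetric, unfolded comp_def])
    also have "\<dots> = (?A *\<^sub>v v) $ f i"
      using fn[OF i] v(1) by (auto simp: adjacency_matrix_wrt_def n_def scalar_prod_def
          atLeast0LessThan intro!: sum.cong)
    also have "\<dots> = (e \<cdot>\<^sub>v w) $ i"
      using i fn[OF i] v by (simp add: w_def)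
    finally show "(?B *\<^sub>v w) $ i = (e \<cdot>\<^sub>v w) $ i" .
  qed (simp add: adjacency_matrix_wrt_def len w_def)
  ultimately show ?thesis
    using w by (auto simp: eigenvalue_def eigenvector_def adjacency_matrix_wrt_def len)
qed

lemma spectrum_adjacency_matrix:
  assumes "distinct vs" "set vs = pverts G"
  shows "spectrum (adjacency_matrix G) = spectrum (adjacency_matrix_wrt vs G)"
proof -
  define ws where "ws = (SOME vs. distinct vs \<and> set vs = pverts G)"
  have ws: "distinct ws \<and> set ws = pverts G"
    unfolding ws_def by (rule someI[of _ vs]) (use assms in simp)
  have "eigenvalue (adjacency_matrix_wrt ws G) e \<longleftrightarrow> eigenvalue (adjacency_matrix_wrt vs G) e" for e
    using eigenvalue_adjacency_matrix_wrt[of vs ws G e] eigenvalue_adjacency_matrix_wrt[of ws vs G e]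
      assms ws by auto
  then show ?thesis unfolding spectrum_def adjacency_matrix_def ws_def by (intro Collect_cong)
qed

section \<open>Complete split graphs\<close>

text \<open>
  The graph \<open>S\<^bsub>n,s\<^esub>\<close> for \<open>s < n\<close>: the vertices below \<open>s\<close> form the clique, the other \<open>n - s\<close>
  vertices the independent set, and all edges between the two parts are present.
\<close>

definition complete_split_graph :: "nat \<Rightarrow> nat \<Rightarrow> nat pair_pre_digraph" where
  "complete_split_graph n s =
     \<lparr> pverts = {..<n},
       parcs = {(u, v). u < n \<and> v < n \<and> u \<noteq> v \<and> (u < s \<or> v < s)} \<rparr>"

lemma pair_graph_complete_split_graph: "pair_graph (complete_split_graph n s)"
proof -
  have "finite (parcs (complete_split_graph n s))"
    by (rule finite_subset[of _ "{..<n} \<times> {..<n}"]) (auto simp: complete_split_graph_def)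
  then show ?thesis
    by unfold_locales (auto simp: complete_split_graph_def symmetric_def intro!: symI)
qed

text \<open>
  For graphs without parallel arcs, \<^const>\<open>digraph_iso\<close> is the usual notion: a bijection of the
  vertices that maps the arcs onto the arcs.
\<close>

lemma digraph_iso_with_proj_iff:
  assumes "pair_wf_digraph G"
  shows "digraph_iso (with_proj G) (with_proj H) \<longleftrightarrow>
    (\<exists>f. bij_betw f (pverts G) (pverts H) \<and> parcs H = map_prod f f ` parcs G)"
    (is "?L \<longleftrightarrow> ?R")
proof
  assume ?L
  then obtain h where h: "pre_digraph.digraph_isomorphism (with_proj G) h"
      and H: "with_proj H = app_iso h (with_proj G)"
    by (auto simp: digraph_iso_def)
  have V: "pverts H = iso_verts h ` pverts G" and A: "parcs H = iso_arcs h ` parcs G"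
      and t: "iso_tail h = fst" and d: "iso_head h = snd"
    using H by (auto simp: with_proj_def app_iso_def)
  have "iso_arcs h a = map_prod (iso_verts h) (iso_verts h) a" if "a \<in> parcs G" for a
    using h that t d by (auto simp: pre_digraph.digraph_isomorphism_def with_proj_def prod_eq_iff)
  then have "parcs H = map_prod (iso_verts h) (iso_verts h) ` parcs G"
    unfolding A by (intro image_cong) auto
  moreover have "bij_betw (iso_verts h) (pverts G) (pverts H)"
    using h V by (auto simp: pre_digraph.digraph_isomorphism_def bij_betw_def)
  ultimately show ?R by blast
next
  assume ?R
  then obtain f where f: "bij_betw f (pverts G) (pverts H)"
      and A: "parcs H = map_prod f f ` parcs G"
    by blast
  interpret pair_wf_digraph G by fact
  let ?h = "\<lparr>iso_verts = f, iso_arcs = map_prod f f, iso_head = snd, iso_tail = fst\<rparr>"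
  have inj: "inj_on f (pverts G)" using f by (simp add: bij_betw_def)
  have "inj_on (map_prod f f) (parcs G)"
    by (rule inj_on_subset[OF map_prod_inj_on[OF inj inj]]) (auto dest: wellformed')
  then have "pre_digraph.digraph_isomorphism (with_proj G) ?h"
    using inj wf_digraph_wp_iff[of G] assms by (auto simp: pre_digraph.digraph_isomorphism_def)
  moreover have "with_proj H = app_iso ?h (with_proj G)"
    using f A by (simp add: with_proj_def app_iso_def bij_betw_def)
  ultimately show ?L by (auto simp: digraph_iso_def)
qed

end

theory Submission
  imports Defs "HOL-Analysis.Function_Topology"
begin

text \<open>
  Let \<open>s = 2k - 1\<close> and \<open>d = 3k - 2\<close>, and suppose \<open>\<rho>(G) \<ge> \<rho>(S\<^bsub>n,s\<^esub>)\<close>. Removing shortest cycles one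
  after another shows that every subgraph of \<open>G\<close> has a vertex of degree at most \<open>d\<close>, which bounds
  bilinear sums over the arcs linearly. Applied to a Perron vector \<open>x\<close> with maximum 1, these bounds
  say that few vertices have \<open>x \<ge> 1/(40k\<^sup>2)\<close>. By a bipartite version of the cycle argument almost
  every vertex has at most \<open>s\<close> neighbours among them, so the eigenvalue equation at the maximum
  forces more than half of all vertices to be adjacent to exactly \<open>s\<close> of them, each with \<open>x\<close> close
  to 1. These hubs are the same \<open>s\<close> vertices \<open>U\<close> throughout, for otherwise \<open>2k\<close> hubs
  would have more than \<open>2k\<close> common neighbours. Adding the missing edges at \<open>U\<close> and deleting the
  edges off \<open>U\<close> does not decrease the quadratic form at \<open>x\<close>: off \<open>U\<close> the graph is a forest,
  whose edges can be charged to distinct vertices that miss a neighbour in \<open>U\<close>. Hence \<open>G\<close> is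
  the complete split graph.
\<close>

section \<open>Disjoint cycles\<close>

text \<open>Cycles are vertex lists over a neighbourhood function instead of arc walks, so that
  segments can be cut out and closed up again by list operations;
  \<open>undirected_cycle_if_cyc\<close> translates back.\<close>

definition cyc :: "('a \<Rightarrow> 'a set) \<Rightarrow> 'a list \<Rightarrow> bool" where
  "cyc N xs \<longleftrightarrow> 3 \<le> length xs \<and> distinct xs \<and> successively (\<lambda>u v. v \<in> N u) xs \<and> hd xs \<in> N (last xs)"

text \<open>Peeling off one cycle at a time from the available vertices \<open>X\<close> matches the
  inductions on \<open>k\<close> below.\<close>

primrec disjoint_cycles :: "('a \<Rightarrow> 'a set) \<Rightarrow> nat \<Rightarrow> 'a set \<Rightarrow> bool" where
  "disjoint_cycles N 0 X \<longleftrightarrow> True"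
| "disjoint_cycles N (Suc k) X \<longleftrightarrow>
     (\<exists>xs. cyc N xs \<and> set xs \<subseteq> X \<and> disjoint_cycles N k (X - set xs))"

lemma cyc_mono: "cyc N xs \<Longrightarrow> (\<And>v. N v \<subseteq> N' v) \<Longrightarrow> cyc N' xs"
  using successively_mono[of "\<lambda>u v. v \<in> N u" xs "\<lambda>u v. v \<in> N' u"] by (auto simp: cyc_def)

lemma disjoint_cycles_mono:
  "disjoint_cycles N k X \<Longrightarrow> X \<subseteq> Y \<Longrightarrow> (\<And>v. N v \<subseteq> N' v) \<Longrightarrow> disjoint_cycles N' k Y"
proof (induction k arbitrary: X Y)
  case (Suc k)
  then obtain xs where xs: "cyc N xs" "set xs \<subseteq> X" "disjoint_cycles N k (X - set xs)"
    by auto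
  have "disjoint_cycles N' k (Y - set xs)"
    using Suc.IH[OF xs(3)] Suc.prems by blast
  moreover have "cyc N' xs" using cyc_mono[OF xs(1)] Suc.prems(3) by blast
  ultimately show ?case using xs(2) Suc.prems(2) by auto
qed simp

lemma exists_three:
  assumes "finite A" "3 \<le> card A"
  obtains i j l :: nat where "i \<in> A" "j \<in> A" "l \<in> A" "i < j" "j < l"
proof -
  obtain B where B: "B \<subseteq> A" "card B = 3" "finite B"
    using obtain_subset_with_card_n[OF assms(2)] by blast
  define xs where "xs = sorted_list_of_set B"
  have "length xs = 3" "set xs = B" "sorted_wrt (<) xs"
    using B by (simp_all add: xs_def)
  then have "xs ! 0 \<in> A" "xs ! 1 \<in> A" "xs ! 2 \<in> A" "xs ! 0 < xs ! 1" "xs ! 1 < xs ! 2"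
    using B by (auto simp: sorted_wrt_nth_less intro!: subsetD[OF B(1)])
  then show ?thesis using that by blast
qed

section \<open>Shortest cycles and minimum degree\<close>

locale nbhd =
  fixes N :: "'a \<Rightarrow> 'a set"
  assumes sym: "u \<in> N v \<Longrightarrow> v \<in> N u"
    and irrefl: "v \<notin> N v"
begin

lemma successively_rev_iff:
  "successively (\<lambda>u v. v \<in> N u) (rev xs) \<longleftrightarrow> successively (\<lambda>u v. v \<in> N u) xs"
proof -
  have "(\<lambda>u v. u \<in> N v) = (\<lambda>u v. v \<in> N u)" using sym by blast
  then show ?thesis by (simp only: successively_rev)
qed

text \<open>The rooted form: the end of a longest path other than the root closes a cycle.\<close>

lemma exists_cyc:
  assumes fin: "finite Z" and ne: "Z - {a} \<noteq> {}"
    and deg: "\<And>v. v \<in> Z - {a} \<Longrightarrow> 2 \<le> card (N v \<inter> Z)"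
  shows "\<exists>xs. cyc N xs \<and> set xs \<subseteq> Z"
proof -
  define P where "P = {p. distinct p \<and> set p \<subseteq> Z \<and> successively (\<lambda>u v. v \<in> N u) p}"
  have other: "\<exists>y\<in>N v \<inter> Z. y \<noteq> z" if "v \<in> Z - {a}" for v z
  proof (rule ccontr)
    assume "\<not> ?thesis"
    then have "N v \<inter> Z \<subseteq> {z}" by auto
    then have "card (N v \<inter> Z) \<le> 1" using card_mono[of "{z}"] by fastforce
    with deg[OF that] show False by simp
  qed
  have bound: "length p \<le> card Z" if "p \<in> P" for p
    using that card_mono[OF fin, of "set p"] by (auto simp: P_def distinct_card)
  obtain z where z: "z \<in> Z - {a}" using ne by auto
  obtain z' where z': "z' \<in> N z \<inter> Z" "z' \<noteq> z" using other[OF z] by blast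
  have P2: "[z, z'] \<in> P" using z z' by (auto simp: P_def)
  then obtain p where p: "p \<in> P" and pmax: "\<And>q. q \<in> P \<Longrightarrow> length q \<le> length p"
    using ex_has_greatest_nat[of "\<lambda>p. p \<in> P" "[z, z']" length "Suc (card Z)"] bound
    by (metis le_imp_less_Suc)
  have len2: "2 \<le> length p" using pmax[OF P2] by simp
  \<comment> \<open>The ends of \<open>p\<close> are distinct, so if its head is the root
    \<open>a\<close>, the reversed path starts elsewhere, where the degree condition holds.\<close>
  define q where "q = (if hd p = a then rev p else p)"
  have qP: "q \<in> P" using p by (auto simp: q_def P_def successively_rev_iff simp del: successively_rev)
  have qlen: "length q = length p" by (simp add: q_def)
  have "hd p \<noteq> last p" using p len2
    by (cases p) (auto simp: P_def)
  then have hdq: "hd q \<noteq> a" using len2 by (auto simp: q_def hd_rev)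
  obtain x0 x1 r where q: "q = x0 # x1 # r"
    using len2 qlen by (metis Suc_le_length_iff numeral_2_eq_2)
  have "x0 \<in> Z - {a}" using qP hdq q by (auto simp: P_def)
  \<comment> \<open>By maximality this second neighbour lies on the path, and beyond
    \<open>x1\<close>, so closing up gives at least three vertices.\<close>
  then obtain y where y: "y \<in> N x0" "y \<in> Z" "y \<noteq> x1" using other by blast
  have "y \<in> set q"
  proof (rule ccontr)
    assume "y \<notin> set q"
    then have "y # q \<in> P" using qP y sym q by (auto simp: P_def)
    then show False using pmax[of "y # q"] qlen by simp
  qed
  moreover have "y \<noteq> x0" using y irrefl by blast
  ultimately have "y \<in> set r" using y q by auto
  then obtain r1 r2 where r: "r = r1 @ y # r2" by (meson split_list)
  define xs where "xs = x0 # x1 # r1 @ [y]"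
  have eq: "q = xs @ r2" by (simp add: xs_def q r)
  have "successively (\<lambda>u v. v \<in> N u) xs" "distinct xs" "set xs \<subseteq> Z"
    using qP unfolding P_def eq by (auto simp: successively_append_iff)
  then have "cyc N xs" using y sym by (auto simp: cyc_def xs_def)
  then show ?thesis using \<open>set xs \<subseteq> Z\<close> by blast
qed

text \<open>A shortest cycle, of length \<open>g\<close>, works. Two neighbours of an outside vertex
  at positions \<open>i < j\<close> close a cycle of length \<open>j - i + 2\<close>, which is at
  least \<open>g\<close>; three of them would give \<open>2 * g \<le> (g - 1) + 4\<close>, so
  \<open>g \<le> 3\<close>. A chord would shorten the cycle.\<close>

lemma exists_short_cyc:
  assumes "cyc N xs0" "set xs0 \<subseteq> X"
  obtains xs where "cyc N xs" "set xs \<subseteq> X"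
    "\<And>v. v \<in> set xs \<Longrightarrow> card (N v \<inter> set xs) \<le> 4"
    "\<And>v. v \<in> X - set xs \<Longrightarrow> card (N v \<inter> set xs) \<le> 3"
    "\<And>v. v \<in> X - set xs \<Longrightarrow> 3 < length xs \<Longrightarrow> card (N v \<inter> set xs) \<le> 2"
proof -
  obtain xs where xs: "cyc N xs" "set xs \<subseteq> X"
    and min: "\<And>ys. cyc N ys \<Longrightarrow> set ys \<subseteq> X \<Longrightarrow> length xs \<le> length ys"
    using ex_has_least_nat[of "\<lambda>ys. cyc N ys \<and> set ys \<subseteq> X" xs0 length] assms by blast
  define g where "g = length xs"
  have suc: "successively (\<lambda>u v. v \<in> N u) xs" and dist: "distinct xs" and g3: "3 \<le> g"
    using xs by (auto simp: cyc_def g_def)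
  define seg where "seg i j = take (Suc (j - i)) (drop i xs)" for i j
  have seg: "length (seg i j) = Suc (j - i)" "distinct (seg i j)" "set (seg i j) \<subseteq> set xs"
    "successively (\<lambda>u v. v \<in> N u) (seg i j)" "hd (seg i j) = xs ! i" "last (seg i j) = xs ! j"
    "seg i j \<noteq> []"
    if "i < j" "j < g" for i j
  proof -
    show len: "length (seg i j) = Suc (j - i)" using that by (simp add: seg_def g_def)
    then show ne: "seg i j \<noteq> []" by auto
    show "distinct (seg i j)" using dist by (simp add: seg_def)
    show "set (seg i j) \<subseteq> set xs" unfolding seg_def
      by (meson order_trans set_drop_subset set_take_subset)
    show "successively (\<lambda>u v. v \<in> N u) (seg i j)"
      using suc that by (auto simp: successively_conv_nth seg_def g_def)
    show "hd (seg i j) = xs ! i" using that by (simp add: seg_def hd_drop_conv_nth g_def hd_take)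
    have "last (seg i j) = seg i j ! (j - i)" using len ne by (simp add: last_conv_nth)
    also have "\<dots> = xs ! j" using that by (simp add: seg_def g_def)
    finally show "last (seg i j) = xs ! j" .
  qed
  have outer: "g \<le> j - i + 2"
    if "v \<in> X - set xs" "i < j" "j < g" "xs ! i \<in> N v" "xs ! j \<in> N v" for v i j
  proof -
    have "cyc N (v # seg i j)" using that seg[of i j] sym by (auto simp: cyc_def successively_Cons)
    moreover have "set (v # seg i j) \<subseteq> X" using seg[of i j] that xs(2) by auto
    ultimately show ?thesis using min[of "v # seg i j"] seg(1)[of i j] that by (simp add: g_def)
  qed
  have chord: "i = 0 \<and> j = g - 1" if "Suc i < j" "j < g" "xs ! i \<in> N (xs ! j)" for i j
  proof -
    have "cyc N (seg i j)" using that seg[of i j] by (auto simp: cyc_def)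
    moreover have "set (seg i j) \<subseteq> X" using seg[of i j] that xs(2) by auto
    ultimately have "length xs \<le> Suc (j - i)" using min[of "seg i j"] seg(1)[of i j] that by simp
    then show ?thesis using that by (auto simp: g_def)
  qed
  have idx: "finite {i. i < g \<and> xs ! i \<in> N v}"
    "card {i. i < g \<and> xs ! i \<in> N v} = card (N v \<inter> set xs)" for v
  proof -
    have "bij_betw (\<lambda>i. xs ! i) {i. i < g \<and> xs ! i \<in> N v} (N v \<inter> set xs)"
      using dist by (auto simp: bij_betw_def inj_on_def nth_eq_iff_index_eq g_def in_set_conv_nth)
    then show "card {i. i < g \<and> xs ! i \<in> N v} = card (N v \<inter> set xs)"
      by (rule bij_betw_same_card)
  qed simp
  have out2: "card (N v \<inter> set xs) \<le> 2" if v: "v \<in> X - set xs" and "3 < length xs" for v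
  proof (rule ccontr)
    assume "\<not> ?thesis"
    then have "3 \<le> card {i. i < g \<and> xs ! i \<in> N v}" using idx by simp
    from exists_three[OF idx(1) this] obtain i j l
      where "i \<in> {i. i < g \<and> xs ! i \<in> N v}" "j \<in> {i. i < g \<and> xs ! i \<in> N v}"
        "l \<in> {i. i < g \<and> xs ! i \<in> N v}" "i < j" "j < l" .
    with outer[OF v, of i j] outer[OF v, of j l] that(2) show False by (auto simp: g_def)
  qed
  show thesis
  proof (rule that[OF xs])
    fix v assume "v \<in> set xs"
    then obtain m where m: "m < g" "v = xs ! m" by (auto simp: in_set_conv_nth g_def)
    \<comment> \<open>The ends of \<open>xs\<close> stand for the neighbours across the seam. The
      truncated \<open>m - 1\<close> at \<open>m = 0\<close> and the position \<open>Suc m\<close>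
      past the end only enlarge the right-hand set, at the price of 4 instead of 2.\<close>
    have "N v \<inter> set xs \<subseteq> {xs ! (m - 1), xs ! Suc m, xs ! 0, xs ! (g - 1)}"
    proof
      fix u assume u: "u \<in> N v \<inter> set xs"
      then obtain i where i: "i < g" "u = xs ! i" by (auto simp: in_set_conv_nth g_def)
      have "i \<noteq> m" using u irrefl i m by auto
      then consider "i = m - 1" | "i = Suc m" | "Suc i < m" | "Suc m < i" by linarith
      then show "u \<in> {xs ! (m - 1), xs ! Suc m, xs ! 0, xs ! (g - 1)}"
      proof cases
        case 3
        then show ?thesis using chord[of i m] i m u by auto
      next
        case 4
        then show ?thesis using chord[of m i] i m u sym by auto
      qed (use i in auto)
    qed
    then have "card (N v \<inter> set xs) \<le> card {xs ! (m - 1), xs ! Suc m, xs ! 0, xs ! (g - 1)}"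
      by (intro card_mono) auto
    also have "\<dots> \<le> 4" by (simp add: card_insert_if)
    finally show "card (N v \<inter> set xs) \<le> 4" .
  next
    fix v assume v: "v \<in> X - set xs"
    show "card (N v \<inter> set xs) \<le> 3"
    proof (cases "3 < length xs")
      case False
      have "card (N v \<inter> set xs) \<le> card (set xs)" by (intro card_mono) auto
      also have "\<dots> \<le> 3" using False card_length[of xs] by linarith
      finally show ?thesis .
    qed (use out2[OF v] in simp)
  qed (use out2 in blast)
qed

text \<open>The degree bound is \<open>3 * k - 1\<close>. Removing a shortest cycle costs an outside
  vertex at most 3 neighbours, which pays for lowering \<open>k\<close> by 1. As long as another
  cycle is wanted, vertices on the removed one have a neighbour outside it, so something is
  left.\<close>

lemma disjoint_cycles_if_min_degree:
  assumes "finite X" "X \<noteq> {}" "\<And>v. v \<in> X \<Longrightarrow> 3 * k \<le> card (N v \<inter> X) + 1"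
  shows "disjoint_cycles N k X"
  using assms
proof (induction k arbitrary: X)
  case (Suc k)
  obtain a where "a \<in> X" using Suc.prems by auto
  have deg2: "2 \<le> card (N v \<inter> X)" if "v \<in> X" for v using Suc.prems(3)[OF that] by simp
  have "X - {a} \<noteq> {}"
  proof
    assume "X - {a} = {}"
    then have "N a \<inter> X = {}" using irrefl by auto
    then show False using deg2[OF \<open>a \<in> X\<close>] by simp
  qed
  then obtain xs0 where "cyc N xs0" "set xs0 \<subseteq> X"
    using exists_cyc[OF Suc.prems(1), of a] deg2 by blast
  then obtain xs where xs: "cyc N xs" "set xs \<subseteq> X"
    "\<And>v. v \<in> set xs \<Longrightarrow> card (N v \<inter> set xs) \<le> 4"
    "\<And>v. v \<in> X - set xs \<Longrightarrow> card (N v \<inter> set xs) \<le> 3"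
    using exists_short_cyc by metis
  have split: "card (N v \<inter> X) = card (N v \<inter> set xs) + card (N v \<inter> (X - set xs))" for v
    using Suc.prems(1) xs(2)
    by (subst card_Un_disjoint[symmetric]) (auto intro!: arg_cong[of _ _ card] finite_subset)
  have "disjoint_cycles N k (X - set xs)"
  proof (cases "k = 0")
    case False
    obtain v where v: "v \<in> set xs" using xs(1) by (cases xs) (auto simp: cyc_def)
    have "card (N v \<inter> (X - set xs)) \<noteq> 0"
      using split[of v] xs(3)[OF v] Suc.prems(3)[of v] v xs(2) False by force
    then have "N v \<inter> (X - set xs) \<noteq> {}" by (metis card.empty)
    then have ne: "X - set xs \<noteq> {}" by blast
    show ?thesis
    proof (rule Suc.IH[OF _ ne])
      fix v assume v: "v \<in> X - set xs"
      show "3 * k \<le> card (N v \<inter> (X - set xs)) + 1"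
        using split[of v] xs(4)[OF v] Suc.prems(3)[of v] v by simp
    qed (use Suc.prems in simp)
  qed simp
  then show ?case using xs by auto
qed simp

section \<open>Sums over the arcs of a degenerate graph\<close>

text \<open>
  The vertices outside \<open>A\<close> can be removed one at a time so that each has at most \<open>d\<close>
  neighbours among those still present.
\<close>

lemma sum_arcs_le:
  fixes f g :: "'a \<Rightarrow> real"
  assumes "finite V" "finite A" "V \<inter> A = {}"
    and "\<And>Z. Z \<subseteq> V \<Longrightarrow> Z \<noteq> {} \<Longrightarrow> \<exists>v\<in>Z. card (N v \<inter> (Z \<union> A)) \<le> d"
    and "\<And>v. v \<in> V \<union> A \<Longrightarrow> 0 \<le> f v \<and> f v \<le> Mf" "\<And>v. v \<in> V \<union> A \<Longrightarrow> 0 \<le> g v \<and> g v \<le> Mg"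
  shows "(\<Sum>u\<in>V \<union> A. \<Sum>w\<in>N u \<inter> (V \<union> A). f u * g w)
    \<le> real d * (Mg * sum f V + Mf * sum g V) + (\<Sum>u\<in>A. \<Sum>w\<in>N u \<inter> A. f u * g w)"
  using assms
proof (induction "card V" arbitrary: V)
  case 0
  then show ?case by simp
next
  case (Suc m)
  then obtain v where v: "v \<in> V" and dv: "card (N v \<inter> (V \<union> A)) \<le> d"
    using Suc.prems(4)[of V] by fastforce
  define W where "W = V - {v}"
  have VW: "V = insert v W" "v \<notin> W" "finite W" "v \<notin> A" using v Suc.prems by (auto simp: W_def)
  define Y where "Y = W \<union> A"
  have Y: "finite Y" "v \<notin> Y" "V \<union> A = insert v Y" using VW Suc.prems by (auto simp: Y_def)
  have IH: "(\<Sum>u\<in>Y. \<Sum>w\<in>N u \<inter> Y. f u * g w)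
    \<le> real d * (Mg * sum f W + Mf * sum g W) + (\<Sum>u\<in>A. \<Sum>w\<in>N u \<inter> A. f u * g w)"
    unfolding Y_def
  proof (rule Suc.hyps(1))
    show "m = card W" using Suc.hyps(2) VW by simp
    show "\<exists>v\<in>Z. card (N v \<inter> (Z \<union> A)) \<le> d" if "Z \<subseteq> W" "Z \<noteq> {}" for Z
      using Suc.prems(4)[of Z] that by (auto simp: W_def)
  qed (use VW Suc.prems in auto)
  define D where "D = N v \<inter> Y"
  have D: "finite D" "card D \<le> d" using Y dv irrefl[of v] by (auto simp: D_def)
  have Mf: "0 \<le> f v" "f v \<le> Mf" "0 \<le> Mf" and Mg: "0 \<le> g v" "g v \<le> Mg" "0 \<le> Mg"
    using Suc.prems(5,6)[of v] v by auto
  have fD: "sum f D \<le> real d * Mf"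
  proof -
    have "sum f D \<le> real (card D) * Mf"
      using Suc.prems(5) Y by (intro sum_bounded_above) (auto simp: D_def)
    also have "\<dots> \<le> real d * Mf" using D Mf by (intro mult_right_mono) auto
    finally show ?thesis .
  qed
  have gD: "sum g D \<le> real d * Mg"
  proof -
    have "sum g D \<le> real (card D) * Mg"
      using Suc.prems(6) Y by (intro sum_bounded_above) (auto simp: D_def)
    also have "\<dots> \<le> real d * Mg" using D Mg by (intro mult_right_mono) auto
    finally show ?thesis .
  qed
  have one: "(\<Sum>w\<in>N u \<inter> insert v Y. f u * g w)
      = (if u \<in> N v then f u * g v else 0) + (\<Sum>w\<in>N u \<inter> Y. f u * g w)" for u
  proof (cases "u \<in> N v")
    case True
    then have "N u \<inter> insert v Y = insert v (N u \<inter> Y)" using sym by auto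
    then show ?thesis using True Y by simp
  next
    case False
    then have "N u \<inter> insert v Y = N u \<inter> Y" using sym by auto
    then show ?thesis using False by simp
  qed
  \<comment> \<open>Besides the arcs that survive, \<open>v\<close> accounts for its outgoing arcs,
    \<open>f v * sum g D\<close>, and its incoming ones, \<open>sum f D * g v\<close>; both sums run
    over at most \<open>d\<close> neighbours.\<close>
  have "(\<Sum>u\<in>V \<union> A. \<Sum>w\<in>N u \<inter> (V \<union> A). f u * g w)
    = f v * sum g D + ((\<Sum>u\<in>Y. if u \<in> N v then f u * g v else 0) + (\<Sum>u\<in>Y. \<Sum>w\<in>N u \<inter> Y. f u * g w))"
    using Y irrefl[of v] by (simp add: one sum.distrib D_def sum_distrib_left)
  also have "(\<Sum>u\<in>Y. if u \<in> N v then f u * g v else 0) = sum f D * g v"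
    using Y by (simp add: D_def sum.inter_restrict[symmetric] sum_distrib_right Int_commute
        sum.If_cases Collect_conj_eq)
  finally have eq: "(\<Sum>u\<in>V \<union> A. \<Sum>w\<in>N u \<inter> (V \<union> A). f u * g w)
    = f v * sum g D + sum f D * g v + (\<Sum>u\<in>Y. \<Sum>w\<in>N u \<inter> Y. f u * g w)" by simp
  have "f v * sum g D \<le> f v * (real d * Mg)" using gD Mf by (intro mult_left_mono) auto
  moreover have "sum f D * g v \<le> real d * Mf * g v" using fD Mg by (intro mult_right_mono) auto
  ultimately show ?case unfolding eq using IH VW by (simp add: algebra_simps)
qed

lemma sum_arcs_le_degenerate:
  fixes f g :: "'a \<Rightarrow> real"
  assumes "finite V" "\<And>Z. Z \<subseteq> V \<Longrightarrow> Z \<noteq> {} \<Longrightarrow> \<exists>v\<in>Z. card (N v \<inter> Z) \<le> d"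
    and "\<And>v. v \<in> V \<Longrightarrow> 0 \<le> f v \<and> f v \<le> Mf" "\<And>v. v \<in> V \<Longrightarrow> 0 \<le> g v \<and> g v \<le> Mg"
  shows "(\<Sum>u\<in>V. \<Sum>w\<in>N u \<inter> V. f u * g w) \<le> real d * (Mg * sum f V + Mf * sum g V)"
  using sum_arcs_le[of V "{}" d f Mf g Mg] assms by simp

text \<open>The indicator functions of \<open>X\<close> and \<open>Y\<close>, both bounded by 1,
  turn the weighted bound into a count of arcs.\<close>

lemma sum_degree_le_degenerate:
  assumes fin: "finite V" and deg: "\<And>Z. Z \<subseteq> V \<Longrightarrow> Z \<noteq> {} \<Longrightarrow> \<exists>v\<in>Z. card (N v \<inter> Z) \<le> d"
    and X: "X \<subseteq> V" and Y: "Y \<subseteq> V"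
  shows "(\<Sum>u\<in>X. card (N u \<inter> Y)) \<le> d * (card X + card Y)"
proof -
  have finXY: "finite X" "finite Y" using finite_subset[OF X] finite_subset[OF Y] fin by auto
  have "(\<Sum>u\<in>V. \<Sum>w\<in>N u \<inter> V. of_bool (u \<in> X) * of_bool (w \<in> Y))
      \<le> real d * (1 * (\<Sum>u\<in>V. of_bool (u \<in> X)) + 1 * (\<Sum>w\<in>V. of_bool (w \<in> Y)))"
    by (rule sum_arcs_le_degenerate[OF fin deg]) auto
  also have "\<dots> = real (d * (card X + card Y))"
    using fin X Y by (simp add: inf.absorb2)
  also have "(\<Sum>u\<in>V. \<Sum>w\<in>N u \<inter> V. of_bool (u \<in> X) * of_bool (w \<in> Y))
      = (\<Sum>u\<in>X. real (card (N u \<inter> Y)))"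
  proof (rule sum.mono_neutral_cong_right[OF fin X])
    fix u assume "u \<in> X"
    moreover have "N u \<inter> V \<inter> Y = N u \<inter> Y" using Y by auto
    ultimately show "(\<Sum>w\<in>N u \<inter> V. of_bool (u \<in> X) * of_bool (w \<in> Y)) = real (card (N u \<inter> Y))"
      using fin by simp
  qed auto
  also have "\<dots> = real (\<Sum>u\<in>X. card (N u \<inter> Y))" by simp
  finally show ?thesis by (simp only: of_nat_le_iff)
qed

end

text \<open>The cyclic successor maps the positions of vertices in \<open>W\<close> injectively to
  positions of vertices in \<open>L\<close>.\<close>

lemma card_cyc_bipartite_le:
  assumes "cyc N xs" and out: "\<And>w. w \<in> W \<Longrightarrow> N w \<inter> set xs \<subseteq> L"
  shows "card (W \<inter> set xs) \<le> card (L \<inter> set xs)"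
proof -
  define g where "g = length xs"
  have dist: "distinct xs" and g3: "3 \<le> g" and suc: "successively (\<lambda>u v. v \<in> N u) xs"
    and hl: "hd xs \<in> N (last xs)" and "xs \<noteq> []"
    using assms(1) by (auto simp: cyc_def g_def)
  then have last: "xs ! 0 \<in> N (xs ! (g - 1))"
    by (simp add: g_def hd_conv_nth last_conv_nth)
  define I where "I = {i. i < g \<and> xs ! i \<in> W}"
  define J where "J = {i. i < g \<and> xs ! i \<in> L}"
  define s where "s i = (if i = g - 1 then 0 else Suc i)" for i
  have step: "xs ! s i \<in> N (xs ! i)" "s i < g" if "i < g" for i
    using that last suc g3 by (auto simp: s_def successively_conv_nth g_def)
  have "s ` I \<subseteq> J"
    using step out unfolding I_def J_def g_def by fastforce
  moreover have "inj_on s I" using g3 by (auto simp: inj_on_def s_def I_def)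
  moreover have "finite J" by (simp add: J_def)
  ultimately have "card I \<le> card J" by (metis card_inj_on_le)
  moreover have "bij_betw ((!) xs) I (W \<inter> set xs)" "bij_betw ((!) xs) J (L \<inter> set xs)"
    using dist by (auto simp: I_def J_def bij_betw_def inj_on_def nth_eq_iff_index_eq g_def in_set_conv_nth)
  ultimately show ?thesis by (metis bij_betw_same_card)
qed

text \<open>Neither \<open>W\<close> nor \<open>L\<close> spans an edge, so a shortest cycle
  alternates between them. Removing it keeps \<open>card L < card W\<close>, and as it is longer
  than a triangle, it costs each outside vertex at most 2 neighbours.\<close>

lemma (in nbhd) disjoint_cycles_bipartite_aux:
  assumes "finite W" "finite L" "W \<inter> L = {}" "card L < card W"
    and "\<And>w. w \<in> W \<Longrightarrow> N w \<inter> W = {}" "\<And>l. l \<in> L \<Longrightarrow> N l \<inter> L = {}"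
    and "\<And>w. w \<in> W \<Longrightarrow> 2 * k \<le> card (N w \<inter> L)"
  shows "disjoint_cycles N k (W \<union> L)"
  using assms
proof (induction k arbitrary: W L)
  case (Suc k)
  have "\<exists>xs0. cyc N xs0 \<and> set xs0 \<subseteq> W \<union> L"
  proof (rule ccontr)
    assume no: "\<not> ?thesis"
    have deg: "\<exists>v\<in>Z. card (N v \<inter> Z) \<le> 1" if Z: "Z \<subseteq> W \<union> L" "Z \<noteq> {}" for Z
    proof (rule ccontr)
      assume "\<not> ?thesis"
      then have d2: "2 \<le> card (N v \<inter> Z)" if "v \<in> Z" for v
        using that by (metis Suc_1 not_less_eq_eq One_nat_def)
      have "finite Z" using finite_subset[OF Z(1)] Suc.prems(1,2) by simp
      obtain a where a: "a \<in> Z" using Z by blast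
      have "N a \<inter> Z \<subseteq> Z - {a}" using irrefl by auto
      then have "Z - {a} \<noteq> {}" using d2[OF a] by fastforce
      then show False using exists_cyc[OF \<open>finite Z\<close>, of a] d2 no Z by blast
    qed
    \<comment> \<open>Without a cycle at most \<open>card W + card L\<close> arcs lead from
      \<open>W\<close> to \<open>L\<close>, which is less than two for each vertex of
      \<open>W\<close>.\<close>
    have "(\<Sum>u\<in>W. card (N u \<inter> L)) \<le> 1 * (card W + card L)"
      by (rule sum_degree_le_degenerate[OF _ deg]) (use Suc.prems(1,2) in auto)
    moreover have "(\<Sum>u\<in>W. 2) \<le> (\<Sum>u\<in>W. card (N u \<inter> L))"
    proof (rule sum_mono)
      fix w assume "w \<in> W"
      from Suc.prems(7)[OF this] show "2 \<le> card (N w \<inter> L)" by simp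
    qed
    ultimately show False using Suc.prems(4) by simp
  qed
  then obtain xs0 where "cyc N xs0" "set xs0 \<subseteq> W \<union> L" by blast
  then obtain xs where xs: "cyc N xs" "set xs \<subseteq> W \<union> L"
    and out: "\<And>v. v \<in> (W \<union> L) - set xs \<Longrightarrow> 3 < length xs \<Longrightarrow> card (N v \<inter> set xs) \<le> 2"
    using exists_short_cyc by metis
  have "length xs \<noteq> 3"
  proof
    assume "length xs = 3"
    then obtain a b c where "xs = [a, b, c]"
      by (metis (no_types, opaque_lifting) length_0_conv length_Suc_conv numeral_3_eq_3)
    then show False using xs Suc.prems(5,6) unfolding cyc_def by auto
  qed
  then have long: "3 < length xs" using xs(1) by (simp add: cyc_def)
  define W' L' where "W' = W - set xs" and "L' = L - set xs"
  have "card (W \<inter> set xs) \<le> card (L \<inter> set xs)"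
    using card_cyc_bipartite_le[OF xs(1), of W L] xs(2) Suc.prems(5) by blast
  moreover have "card W = card W' + card (W \<inter> set xs)" "card L = card L' + card (L \<inter> set xs)"
    using Suc.prems(1,2)
    by (simp_all add: W'_def L'_def card_Diff_subset_Int card_mono[OF _ Int_lower1])
  ultimately have less: "card L' < card W'" using Suc.prems(4) by linarith
  have "disjoint_cycles N k (W' \<union> L')"
  proof (rule Suc.IH)
    fix w assume w: "w \<in> W'"
    have "N w \<inter> L = (N w \<inter> L') \<union> (N w \<inter> (L \<inter> set xs))" by (auto simp: L'_def)
    then have "card (N w \<inter> L) \<le> card (N w \<inter> L') + card (N w \<inter> (L \<inter> set xs))"
      by (metis card_Un_le)
    also have "card (N w \<inter> (L \<inter> set xs)) \<le> card (N w \<inter> set xs)" by (intro card_mono) auto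
    also have "\<dots> \<le> 2" using out long w by (auto simp: W'_def)
    finally show "2 * k \<le> card (N w \<inter> L')" using Suc.prems(7)[of w] w by (simp add: W'_def)
    show "N w \<inter> W' = {}" using Suc.prems(5)[of w] w by (auto simp: W'_def)
  next
    fix l assume "l \<in> L'"
    then show "N l \<inter> L' = {}" using Suc.prems(6)[of l] by (auto simp: L'_def)
  qed (use Suc.prems(1-3) less in \<open>auto simp: W'_def L'_def\<close>)
  also have "W' \<union> L' = W \<union> L - set xs" by (auto simp: W'_def L'_def)
  finally show ?case using xs by auto
qed simp

text \<open>Edges inside \<open>W\<close> or inside \<open>L\<close> are dropped by passing to
  \<open>N'\<close>; cycles for \<open>N'\<close> are cycles for \<open>N\<close>.\<close>

lemma (in nbhd) disjoint_cycles_bipartite: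
  assumes "finite W" "finite L" "W \<inter> L = {}" "card L < card W"
    and "\<And>w. w \<in> W \<Longrightarrow> 2 * k \<le> card (N w \<inter> L)"
  shows "disjoint_cycles N k (W \<union> L)"
proof -
  define N' where "N' v = (if v \<in> W then N v \<inter> L else if v \<in> L then N v \<inter> W else {})" for v
  interpret N': nbhd N'
    using assms(3) by unfold_locales (auto simp: N'_def sym irrefl split: if_splits)
  have "disjoint_cycles N' k (W \<union> L)"
    by (rule N'.disjoint_cycles_bipartite_aux) (use assms in \<open>auto simp: N'_def Int_assoc\<close>)
  then show ?thesis by (rule disjoint_cycles_mono) (auto simp: N'_def)
qed

section \<open>Graphs without \<open>k\<close> disjoint cycles\<close>

context nbhd
begin

text \<open>Contrapositive of \<open>disjoint_cycles_if_min_degree\<close>, in the form of the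
  degeneracy condition that the sums over arcs require.\<close>

lemma exists_small_degree:
  assumes "finite V" "\<not> disjoint_cycles N k V" "Z \<subseteq> V" "Z \<noteq> {}" "1 \<le> k"
  shows "\<exists>v\<in>Z. card (N v \<inter> Z) \<le> 3 * k - 2"
proof (rule ccontr)
  assume "\<not> ?thesis"
  then have "\<And>v. v \<in> Z \<Longrightarrow> 3 * k \<le> card (N v \<inter> Z) + 1" by (force simp: not_le)
  then have "disjoint_cycles N k Z"
    using disjoint_cycles_if_min_degree assms(1,3,4) finite_subset by metis
  then show False using assms(2,3) disjoint_cycles_mono by blast
qed

text \<open>
  A cycle that meets \<open>U\<close> at most in \<open>a\<close> and \<open>R\<close> in few vertices leaves room for \<open>k - 1\<close>
  further cycles between \<open>U - {a}\<close> and \<open>R\<close>. A shortest cycle in \<open>(V - U) \<union> {a}\<close> is such a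
  cycle, because \<open>a\<close> has few neighbours on it.
\<close>

lemma exists_leaf_off_hubs:
  assumes fin: "finite V" and no: "\<not> disjoint_cycles N k V" and k: "1 \<le> k"
    and U: "U \<subseteq> V" "card U = 2 * k - 1" "a \<in> U"
    and R: "R \<subseteq> V - U" "2 * k + 3 \<le> card R" "\<And>r. r \<in> R \<Longrightarrow> U \<subseteq> N r"
    and Z: "Z \<subseteq> V - U" "Z \<noteq> {}"
  shows "\<exists>v\<in>Z. card (N v \<inter> (Z \<union> {a})) \<le> 1"
proof (rule ccontr)
  assume "\<not> ?thesis"
  then have d2: "\<And>v. v \<in> Z \<Longrightarrow> 2 \<le> card (N v \<inter> (Z \<union> {a}))" by (metis Suc_1 not_less_eq_eq)
  have "a \<notin> Z" using Z U by auto
  then have "Z \<union> {a} - {a} = Z" by auto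
  moreover have "finite (Z \<union> {a})" using finite_subset[OF Z(1)] fin by simp
  ultimately obtain xs0 where "cyc N xs0" "set xs0 \<subseteq> Z \<union> {a}"
    using exists_cyc[of "Z \<union> {a}" a] d2 Z(2) by auto
  then have "cyc N xs0" "set xs0 \<subseteq> (V - U) \<union> {a}" using Z by auto
  then obtain xs where xs: "cyc N xs" "set xs \<subseteq> (V - U) \<union> {a}"
    and c: "\<And>v. v \<in> set xs \<Longrightarrow> card (N v \<inter> set xs) \<le> 4"
      "\<And>v. v \<in> (V - U) \<union> {a} - set xs \<Longrightarrow> card (N v \<inter> set xs) \<le> 3"
    using exists_short_cyc by metis
  \<comment> \<open>All of \<open>R\<close> is adjacent to \<open>a\<close>, so the cycle meets
    \<open>R\<close> in at most 4 vertices, whether or not it passes through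
    \<open>a\<close>.\<close>
  have "R \<inter> set xs \<subseteq> N a \<inter> set xs" using R(3) U(3) sym by blast
  then have "card (R \<inter> set xs) \<le> card (N a \<inter> set xs)" by (intro card_mono) auto
  also have "\<dots> \<le> 4" using c[of a] by force
  finally have R4: "card (R \<inter> set xs) \<le> 4" .
  define W L where "W = R - set xs" and "L = U - {a}"
  have finR: "finite R" "finite U" using finite_subset[OF R(1)] finite_subset[OF U(1)] fin by simp_all
  have cL: "card L = 2 * (k - 1)" using U finR by (simp add: L_def)
  have "card W = card R - card (R \<inter> set xs)" using finR by (simp add: W_def card_Diff_subset_Int)
  \<comment> \<open>The surplus in \<open>2 * k + 3\<close> pays for these 4 vertices: at least
    \<open>2 * k - 1\<close> remain, against \<open>card L = 2 * k - 2\<close>.\<close>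
  then have cW: "card L < card W" using R4 R(2) cL k by simp
  have "disjoint_cycles N (k - 1) (W \<union> L)"
  proof (rule disjoint_cycles_bipartite)
    fix w assume "w \<in> W"
    then have "N w \<inter> L = L" using R(3)[of w] by (auto simp: W_def L_def)
    then show "2 * (k - 1) \<le> card (N w \<inter> L)" using cL by simp
  qed (use finR R cW in \<open>auto simp: W_def L_def\<close>)
  moreover have "W \<union> L \<subseteq> V - set xs" using R(1) U(1) xs(2) by (auto simp: W_def L_def)
  ultimately have "disjoint_cycles N (k - 1) (V - set xs)" using disjoint_cycles_mono by blast
  moreover have "set xs \<subseteq> V" using xs(2) U by auto
  ultimately have "disjoint_cycles N (Suc (k - 1)) V" using xs(1) by auto
  then show False using no k by simp
qed

end

section \<open>Quadratic forms on graphs\<close>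

text \<open>The maximum \<open>m\<close> of the quadratic form on the unit sphere is attained;
  absolute values keep a maximiser a maximiser, and varying a single entry by \<open>t\<close>
  forces the eigenvalue equation at that vertex.\<close>

lemma (in nbhd) exists_top_eigenfunction:
  assumes fin: "finite V" and ne: "V \<noteq> {}" and NV: "\<And>v. N v \<subseteq> V"
  shows "\<exists>m (x :: 'a \<Rightarrow> real). (\<forall>v\<in>V. 0 \<le> x v) \<and> (\<exists>v\<in>V. x v \<noteq> 0) \<and>
    (\<forall>v\<in>V. (\<Sum>w\<in>N v. x w) = m * x v) \<and>
    (\<forall>y. (\<Sum>v\<in>V. \<Sum>w\<in>N v. y v * y w) \<le> m * (\<Sum>v\<in>V. (y v)\<^sup>2))"
proof -
  define q :: "('a \<Rightarrow> real) \<Rightarrow> real" where "q y = (\<Sum>v\<in>V. \<Sum>w\<in>N v. y v * y w)" for y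
  define s :: "('a \<Rightarrow> real) \<Rightarrow> real" where "s y = (\<Sum>v\<in>V. (y v)\<^sup>2)" for y
  \<comment> \<open>The vertex type may be infinite. Pinning all coordinates off \<open>V\<close> to
    0 and confining the others to an interval makes the sphere compact in the product
    topology.\<close>
  define K :: "('a \<Rightarrow> real) set" where
    "K = (\<Pi>\<^sub>E v\<in>UNIV. if v \<in> V then {-1..1} else {0}) \<inter> {y. s y = 1}"
  have coord: "continuous_on A (\<lambda>y. y v)" for v and A :: "('a \<Rightarrow> real) set"
    by (rule continuous_on_subset[OF continuous_on_product_coordinates]) simp
  have contq: "continuous_on A q" for A
    unfolding q_def by (intro continuous_intros coord)
  have conts: "continuous_on UNIV s"
    unfolding s_def by (intro continuous_intros coord)
  have "compactin (product_topology (\<lambda>_. euclidean) UNIV)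
      (\<Pi>\<^sub>E v\<in>UNIV. if v \<in> V then {-1..1::real} else {0})"
    by (subst compactin_PiE) auto
  then have "compact (\<Pi>\<^sub>E v\<in>(UNIV :: 'a set). if v \<in> V then {-1..1::real} else {0})"
    by (simp add: euclidean_product_topology)
  moreover have "closed {y. s y = 1}"
    using closed_vimage[OF closed_singleton[of 1] conts] by (simp add: vimage_def)
  ultimately have "compact K" unfolding K_def by (rule compact_Int_closed)
  obtain v0 where v0: "v0 \<in> V" using ne by blast
  have "(\<lambda>v. if v = v0 then 1 else 0) \<in> K"
  proof -
    have "s (\<lambda>v. if v = v0 then 1 else 0) = (\<Sum>v\<in>V. if v = v0 then 1 else 0)"
      unfolding s_def by (rule sum.cong) auto
    then show ?thesis using v0 fin by (auto simp: K_def)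
  qed
  then have "K \<noteq> {}" by blast
  from continuous_attains_sup[OF \<open>compact K\<close> this contq]
  obtain y where y: "y \<in> K" and ymax: "\<And>z. z \<in> K \<Longrightarrow> q z \<le> q y" by blast
  define m where "m = q y"
  have scale: "q (\<lambda>v. c * z v) = c\<^sup>2 * q z" "s (\<lambda>v. c * z v) = c\<^sup>2 * s z" for c z
    by (simp_all add: q_def s_def sum_distrib_left power2_eq_square mult_ac)
  have ray: "q z \<le> m * s z" for z
  proof (cases "s z = 0")
    case True
    then have "z v = 0" if "v \<in> V" for v
      using that fin by (simp add: s_def sum_nonneg_eq_0_iff)
    then have "q z = 0" by (simp add: q_def)
    then show ?thesis using True by simp
  next
    case False
    then have pos: "0 < s z" by (simp add: s_def sum_nonneg order.strict_iff_order)
    define z' where "z' v = (if v \<in> V then z v / sqrt (s z) else 0)" for v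
    have eq: "q z' = q (\<lambda>v. (1 / sqrt (s z)) * z v)" "s z' = s (\<lambda>v. (1 / sqrt (s z)) * z v)"
      using NV by (auto simp: q_def s_def z'_def intro!: sum.cong dest!: subsetD[OF NV])
    have s1: "s z' = 1" unfolding eq scale using pos by (simp add: power_divide)
    have b: "- 1 \<le> z' v \<and> z' v \<le> 1" if "v \<in> V" for v
    proof -
      have "(z' v)\<^sup>2 \<le> s z'" unfolding s_def using that fin by (intro member_le_sum) auto
      then show ?thesis using s1 abs_square_le_1[of "z' v"] by linarith
    qed
    have "z' v = 0" if "v \<notin> V" for v using that by (simp add: z'_def)
    with b have "z' \<in> K" using s1 by (auto simp: K_def)
    then have "q z' \<le> m" using ymax m_def by simp
    then have "(1 / sqrt (s z))\<^sup>2 * q z \<le> m" unfolding eq scale .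
    then show ?thesis using pos by (simp add: power_divide field_simps)
  qed
  define x where "x v = \<bar>y v\<bar>" for v
  have sx: "s x = 1" using y by (simp add: K_def s_def x_def)
  have "q y \<le> q x" unfolding q_def x_def
    by (intro sum_mono) (metis abs_ge_self abs_mult)
  then have qx: "q x = m" using ray[of x] sx m_def by simp
  have eig: "(\<Sum>w\<in>N v. x w) = m * x v" if v: "v \<in> V" for v
  proof -
    define b where "b = m * x v - (\<Sum>w\<in>N v. x w)"
    define c where "c = m - (if v \<in> N v then 1 else 0)"
    have key: "0 \<le> 2 * t * b + t\<^sup>2 * c" for t
    proof -
      define z where "z u = x u + (if u = v then t else 0)" for u
      have finN: "finite (N u)" for u using finite_subset[OF NV fin] .
      have inner: "(\<Sum>w\<in>N u. z w) = (\<Sum>w\<in>N u. x w) + (if v \<in> N u then t else 0)" for u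
        using finN by (simp add: z_def sum.distrib)
      have "q z = (\<Sum>u\<in>V. z u * (\<Sum>w\<in>N u. z w))" by (simp add: q_def sum_distrib_left)
      also have "\<dots> = (\<Sum>u\<in>V. x u * (\<Sum>w\<in>N u. x w) + x u * (if u \<in> N v then t else 0)
          + (if u = v then t * ((\<Sum>w\<in>N v. x w) + (if v \<in> N v then t else 0)) else 0))"
        unfolding inner by (intro sum.cong) (auto simp: z_def algebra_simps dest: sym)
      also have "\<dots> = q x + t * (\<Sum>w\<in>N v. x w) + t * ((\<Sum>w\<in>N v. x w) + (if v \<in> N v then t else 0))"
      proof -
        have "(\<Sum>u\<in>V. x u * (if u \<in> N v then t else 0)) = (\<Sum>u\<in>V. if u \<in> N v then x u * t else 0)"
          by (intro sum.cong) auto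
        also have "\<dots> = (\<Sum>w\<in>N v. x w * t)"
          using fin NV[of v] by (simp add: sum.inter_restrict[symmetric] inf.absorb2)
        finally show ?thesis using fin v
          by (simp add: sum.distrib q_def sum_distrib_left mult.commute)
      qed
      finally have qz: "q z = m + 2 * t * (\<Sum>w\<in>N v. x w) + t\<^sup>2 * (if v \<in> N v then 1 else 0)"
        using qx by (simp add: algebra_simps power2_eq_square)
      have "s z = (\<Sum>u\<in>V. (x u)\<^sup>2 + (if u = v then 2 * t * x v + t\<^sup>2 else 0))"
        unfolding s_def z_def by (intro sum.cong) (auto simp: power2_eq_square algebra_simps)
      also have "\<dots> = 1 + 2 * t * x v + t\<^sup>2"
        using fin v sx by (simp add: sum.distrib s_def)
      finally show ?thesis using ray[of z] qz by (simp add: b_def c_def algebra_simps)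
    qed
    have "b = 0"
    proof (rule ccontr)
      assume b: "b \<noteq> 0"
      define D where "D = \<bar>c\<bar> + 1"
      have D: "0 < D" "c < D" by (auto simp: D_def)
      \<comment> \<open>With this choice the linear term of \<open>key\<close> equals
        \<open>- 2 * D * t^2\<close>, which beats \<open>t^2 * c\<close> because
        \<open>c < D\<close>.\<close>
      define t where "t = - b / D"
      have bt: "b = - D * t" and t0: "t \<noteq> 0" using b D by (simp_all add: t_def)
      have "0 \<le> t\<^sup>2 * (c - 2 * D)"
        using key[of t] unfolding bt by (simp add: power2_eq_square algebra_simps)
      moreover have "t\<^sup>2 * (c - 2 * D) < 0"
        using t0 D by (intro mult_pos_neg) auto
      ultimately show False by simp
    qed
    then show ?thesis by (simp add: b_def)
  qed
  have "\<exists>v\<in>V. x v \<noteq> 0"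
  proof (rule ccontr)
    assume "\<not> ?thesis"
    then have "s x = 0" by (simp add: s_def)
    then show False using sx by simp
  qed
  moreover have "0 \<le> x v" for v by (simp add: x_def)
  ultimately show ?thesis using eig ray unfolding q_def s_def by (intro exI[of _ m] exI[of _ x]) simp
qed

text \<open>\<open>r\<close> is the positive root of the characteristic polynomial of the two-by-two
  quotient matrix of the complete split graph. The difference of the two sides, times
  \<open>r\<close>, is the sum of two nonnegative terms in \<open>gap\<close>; when it is 0, the
  squares summed over \<open>H\<close> vanish, which is the eigenvalue equation off
  \<open>U\<close>.\<close>

lemma split_form_le:
  fixes x :: "'a \<Rightarrow> real" and r :: real
  assumes V: "finite V" "U \<subseteq> V" "card U = s" "card V = n" "1 \<le> s" "s \<le> n"
    and r: "0 < r" "r\<^sup>2 = (real s - 1) * r + real s * (real n - real s)"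
  defines "Q \<equiv> \<Sum>u\<in>V. \<Sum>w\<in>(if u \<in> U then V - {u} else U). x u * x w"
  shows "Q \<le> r * (\<Sum>v\<in>V. (x v)\<^sup>2)"
    and "Q = r * (\<Sum>v\<in>V. (x v)\<^sup>2) \<Longrightarrow> v \<in> V - U \<Longrightarrow> r * x v = sum x U"
proof -
  define H where "H = V - U"
  define p q where "p = sum x U" and "q = sum x H"
  define a b where "a = (\<Sum>v\<in>U. (x v)\<^sup>2)" and "b = (\<Sum>v\<in>H. (x v)\<^sup>2)"
  define m where "m = real n - real s"
  have finU: "finite U" "finite H" using finite_subset[OF V(2,1)] V(1) by (auto simp: H_def)
  have split: "sum f V = sum f U + sum f H" for f :: "'a \<Rightarrow> real"
    unfolding H_def using V by (metis add.commute sum.subset_diff)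
  have cards: "real (card U) = real s" "real (card H) = m"
    using V finU by (simp_all add: H_def m_def card_Diff_subset)
  have "Q = (\<Sum>u\<in>U. x u * (p + q - x u)) + (\<Sum>u\<in>H. x u * p)"
  proof -
    have "(\<Sum>w\<in>V - {u}. x u * x w) = x u * (p + q - x u)" if "u \<in> U" for u
      using that V split[of x]
      by (auto simp: sum_distrib_left[symmetric] sum_diff1 p_def q_def)
    then show ?thesis
      unfolding Q_def split by (auto simp: H_def p_def sum_distrib_left intro!: arg_cong2[of _ _ _ _ "(+)"] sum.cong)
  qed
  also have "\<dots> = p * (p + q) - a + q * p"
    by (simp add: algebra_simps sum.distrib sum_subtractf p_def q_def a_def power2_eq_square
        sum_distrib_left[symmetric] sum_distrib_right[symmetric])
  finally have Q: "Q = p * (p + q) - a + q * p" .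
  \<comment> \<open>Nonnegativity of this sum of squares is the Cauchy-Schwarz inequality
    \<open>p^2 \<le> s * a\<close> on \<open>U\<close>.\<close>
  have 1: "(\<Sum>v\<in>U. (real s * x v - p)\<^sup>2) = real s * (real s * a - p\<^sup>2)"
  proof -
    have "(\<Sum>v\<in>U. (real s * x v - p)\<^sup>2) = (\<Sum>v\<in>U. (real s)\<^sup>2 * (x v)\<^sup>2 - 2 * real s * p * x v + p\<^sup>2)"
      by (intro sum.cong) (auto simp: power2_eq_square algebra_simps)
    also have "\<dots> = (real s)\<^sup>2 * a - 2 * real s * p * p + real s * p\<^sup>2"
      using cards by (simp add: sum.distrib sum_subtractf sum_distrib_left[symmetric] a_def p_def)
    finally show ?thesis by (simp add: power2_eq_square algebra_simps)
  qed
  have 2: "(\<Sum>v\<in>H. (r * x v - p)\<^sup>2) = r\<^sup>2 * b - 2 * r * p * q + m * p\<^sup>2"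
  proof -
    have "(\<Sum>v\<in>H. (r * x v - p)\<^sup>2) = (\<Sum>v\<in>H. r\<^sup>2 * (x v)\<^sup>2 - 2 * r * p * x v + p\<^sup>2)"
      by (intro sum.cong) (auto simp: power2_eq_square algebra_simps)
    also have "\<dots> = r\<^sup>2 * b - 2 * r * p * q + m * p\<^sup>2"
      using cards by (simp add: sum.distrib sum_subtractf sum_distrib_left[symmetric] b_def q_def)
    finally show ?thesis .
  qed
  have "0 \<le> real s * (real s * a - p\<^sup>2)" unfolding 1[symmetric] by (intro sum_nonneg) auto
  then have cs: "0 \<le> real s * a - p\<^sup>2" using V(5) by (simp add: zero_le_mult_iff)
  have "r\<^sup>2 + r = real s * (r + m)" using r(2) by (simp add: m_def algebra_simps)
  then have rr: "r * r * a + r * a = real s * (r + m) * a"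
    by (metis (no_types) distrib_right power2_eq_square)
  have gap: "r * (r * (a + b) - Q) = (r + m) * (real s * a - p\<^sup>2) + (\<Sum>v\<in>H. (r * x v - p)\<^sup>2)"
    unfolding Q 2 using rr by (simp add: power2_eq_square algebra_simps)
  have m0: "0 \<le> m" using V by (simp add: m_def)
  have g1: "0 \<le> (r + m) * (real s * a - p\<^sup>2)" using r m0 cs by simp
  have g2: "0 \<le> (\<Sum>v\<in>H. (r * x v - p)\<^sup>2)" by (intro sum_nonneg) auto
  have ab: "(\<Sum>v\<in>V. (x v)\<^sup>2) = a + b" by (simp add: split a_def b_def)
  have "0 \<le> r * (r * (a + b) - Q)" using gap g1 g2 by linarith
  then show "Q \<le> r * (\<Sum>v\<in>V. (x v)\<^sup>2)" using r(1) ab by (simp add: zero_le_mult_iff)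
  assume eq: "Q = r * (\<Sum>v\<in>V. (x v)\<^sup>2)" and v: "v \<in> V - U"
  have "(\<Sum>v\<in>H. (r * x v - p)\<^sup>2) = 0" using gap g1 g2 eq ab by simp
  then have "(r * x v - p)\<^sup>2 = 0"
    using v finU by (subst (asm) sum_nonneg_eq_0_iff) (auto simp: H_def)
  then show "r * x v = sum x U" by (simp add: p_def)
qed

lemma (in nbhd) eq_split_if_large_eigenvalue:
  fixes x :: "'a \<Rightarrow> real" and r th M :: real
  assumes V: "finite V" "\<And>v. N v \<subseteq> V" and no: "\<not> disjoint_cycles N k V" and k: "1 \<le> k"
    and U: "U \<subseteq> V" "card U = 2 * k - 1" and n: "card V = n"
    and R: "2 * k + 3 \<le> card {w \<in> V - U. U \<subseteq> N w}"
    and x: "\<And>v. v \<in> V \<Longrightarrow> 0 \<le> x v" and M: "\<And>v. v \<in> V - U \<Longrightarrow> x v \<le> M" "\<And>u. u \<in> U \<Longrightarrow> M < x u"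
    and eig: "\<And>v. v \<in> V \<Longrightarrow> (\<Sum>w\<in>N v. x w) = th * x v"
    and r: "0 < r" "r\<^sup>2 = (real (2 * k - 1) - 1) * r + real (2 * k - 1) * (real n - real (2 * k - 1))"
    and th: "r \<le> th"
    and v: "v \<in> V"
  shows "N v = (if v \<in> U then V - {v} else U)"
proof -
  define H where "H = V - U"
  define R where "R = {w \<in> V - U. U \<subseteq> N w}"
  define B where "B = H - R"
  define S where "S u = (if u \<in> U then V - {u} else U)" for u
  have fin: "finite U" "finite H" "finite R" "finite B" "finite (N u)" for u
    using finite_subset[OF U(1) V(1)] finite_subset[OF V(2) V(1)] V(1)
    by (auto simp: H_def R_def B_def)
  have cU: "1 \<le> card U" "card U \<le> n" using U k n card_mono[OF V(1) U(1)] by auto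
  then obtain a where a: "a \<in> U" by fastforce
  have cR: "2 * k + 3 \<le> card R" using assms(8) unfolding R_def .
  then have "R \<noteq> {}" by (metis add_is_0 card.empty le_zero_eq zero_neq_numeral)
  then obtain r0 where "r0 \<in> R" by blast
  then have M0: "0 \<le> M" using M(1)[of r0] x[of r0] by (auto simp: R_def)
  define m0 where "m0 = Min (x ` U)"
  have m0: "M < m0" "\<And>u. u \<in> U \<Longrightarrow> m0 \<le> x u"
  proof -
    have "x ` U \<noteq> {}" using a by blast
    then show "M < m0" using fin M(2) by (simp add: m0_def)
  qed (use fin in \<open>simp add: m0_def\<close>)
  have xpos: "0 \<le> x u * x w" if "u \<in> V" "w \<in> V" for u w using x that by simp
  define T1 where "T1 = (\<Sum>u\<in>U. \<Sum>w\<in>S u - N u. x u * x w)"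
  define T2 where "T2 = (\<Sum>u\<in>H. \<Sum>w\<in>U - N u. x u * x w)"
  define T3 where "T3 = (\<Sum>u\<in>H. \<Sum>w\<in>N u \<inter> H. x u * x w)"
  define QG where "QG = (\<Sum>u\<in>V. \<Sum>w\<in>N u. x u * x w)"
  define QS where "QS = (\<Sum>u\<in>V. \<Sum>w\<in>S u. x u * x w)"
  have splitV: "sum f V = sum f U + sum f H" for f :: "'a \<Rightarrow> real"
    unfolding H_def using V U by (metis add.commute sum.subset_diff)
  have QG_th: "QG = th * (\<Sum>v\<in>V. (x v)\<^sup>2)"
    unfolding QG_def using eig
    by (simp add: sum_distrib_left[symmetric] power2_eq_square) (simp add: sum_distrib_left mult_ac)
  have diff: "QS - QG = T1 + T2 - T3"
  proof -
    have 1: "(\<Sum>w\<in>S u. x u * x w) - (\<Sum>w\<in>N u. x u * x w) = (\<Sum>w\<in>S u - N u. x u * x w)" if "u \<in> U" for u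
    proof -
      have "N u \<subseteq> S u" using V(2)[of u] irrefl[of u] that by (auto simp: S_def)
      moreover have "finite (S u)" using V fin by (auto simp: S_def)
      ultimately show ?thesis by (simp add: sum_diff)
    qed
    have 2: "(\<Sum>w\<in>S u. x u * x w) - (\<Sum>w\<in>N u. x u * x w)
        = (\<Sum>w\<in>U - N u. x u * x w) - (\<Sum>w\<in>N u \<inter> H. x u * x w)" if "u \<in> H" for u
    proof -
      have "(\<Sum>w\<in>N u. x u * x w) = (\<Sum>w\<in>N u \<inter> U. x u * x w) + (\<Sum>w\<in>N u \<inter> H. x u * x w)"
        using fin V(2)[of u] by (subst sum.union_disjoint[symmetric]) (auto simp: H_def intro!: sum.cong)
      moreover have "(\<Sum>w\<in>U. x u * x w) = (\<Sum>w\<in>N u \<inter> U. x u * x w) + (\<Sum>w\<in>U - N u. x u * x w)"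
        using fin by (subst sum.union_disjoint[symmetric]) (auto intro!: sum.cong)
      moreover have "S u = U" using that by (auto simp: S_def H_def)
      ultimately show ?thesis by simp
    qed
    have "(\<Sum>u\<in>U. \<Sum>w\<in>S u. x u * x w) - (\<Sum>u\<in>U. \<Sum>w\<in>N u. x u * x w) = T1"
      unfolding T1_def sum_subtractf[symmetric] using 1 by (intro sum.cong) auto
    moreover have "(\<Sum>u\<in>H. \<Sum>w\<in>S u. x u * x w) - (\<Sum>u\<in>H. \<Sum>w\<in>N u. x u * x w) = T2 - T3"
      unfolding T2_def T3_def sum_subtractf[symmetric] using 2 by (intro sum.cong) auto
    ultimately show ?thesis unfolding QS_def QG_def splitV by linarith
  qed
  have T2: "m0 * sum x B \<le> T2"
  proof -
    have "m0 * sum x B = (\<Sum>u\<in>B. x u * m0)" by (simp add: sum_distrib_left mult.commute)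
    also have "\<dots> \<le> (\<Sum>u\<in>B. \<Sum>w\<in>U - N u. x u * x w)"
    proof (rule sum_mono)
      fix u assume u: "u \<in> B"
      then obtain w where w: "w \<in> U - N u" by (auto simp: B_def R_def H_def)
      have "x u * m0 \<le> x u * x w"
        using m0(2)[of w] w x[of u] u by (intro mult_left_mono) (auto simp: B_def H_def)
      also have "\<dots> \<le> (\<Sum>w\<in>U - N u. x u * x w)"
        using w fin u U xpos by (intro member_le_sum) (auto simp: B_def H_def)
      finally show "x u * m0 \<le> (\<Sum>w\<in>U - N u. x u * x w)" .
    qed
    also have "\<dots> \<le> T2" unfolding T2_def
      using fin U by (intro sum_mono2 sum_nonneg xpos) (auto simp: B_def H_def)
    finally show ?thesis .
  qed
  \<comment> \<open>Each missing arc from \<open>H\<close> to \<open>U\<close> has its reverse among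
    the arcs counted in \<open>T1\<close>.\<close>
  have T12: "T2 \<le> T1"
  proof -
    have "T2 = (\<Sum>u\<in>H. \<Sum>w\<in>{w. w \<in> U \<and> w \<notin> N u}. x u * x w)"
      unfolding T2_def by (intro sum.cong) auto
    also have "\<dots> = (\<Sum>w\<in>U. \<Sum>u\<in>{u. u \<in> H \<and> w \<notin> N u}. x u * x w)"
      using fin by (intro sum.swap_restrict) auto
    also have "\<dots> \<le> T1" unfolding T1_def
    proof (rule sum_mono)
      fix w assume w: "w \<in> U"
      have "(\<Sum>u\<in>{u. u \<in> H \<and> w \<notin> N u}. x u * x w) = (\<Sum>u\<in>{u. u \<in> H \<and> w \<notin> N u}. x w * x u)"
        by (simp add: mult.commute)
      also have "\<dots> \<le> (\<Sum>u\<in>S w - N w. x w * x u)"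
        using V w U sym by (intro sum_mono2 xpos) (auto simp: S_def H_def)
      finally show "(\<Sum>u\<in>{u. u \<in> H \<and> w \<notin> N u}. x u * x w) \<le> (\<Sum>u\<in>S w - N w. x w * x u)" .
    qed
    finally show ?thesis .
  qed
  have T3: "T3 \<le> 2 * M * sum x B"
  proof -
    \<comment> \<open>Lowering the entry at the hub \<open>a\<close> makes \<open>M\<close> a bound
      for all of \<open>y\<close>. By \<open>exists_leaf_off_hubs\<close> the arcs on
      \<open>H\<close> and \<open>a\<close> are then worth at most \<open>2 * M * sum x H\<close>;
      those between \<open>a\<close> and \<open>R\<close> use up \<open>2 * M * sum x R\<close>, so
      \<open>T3\<close> is left with the share of \<open>B\<close>.\<close>
    define y where "y u = (if u = a then M else x u)" for u
    have RV: "R \<subseteq> V - U" and RU: "\<And>r. r \<in> R \<Longrightarrow> U \<subseteq> N r" by (auto simp: R_def)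
    have aH: "a \<notin> H" using a by (simp add: H_def)
    have "(\<Sum>u\<in>H \<union> {a}. \<Sum>w\<in>N u \<inter> (H \<union> {a}). y u * y w)
      \<le> real 1 * (M * sum y H + M * sum y H) + (\<Sum>u\<in>{a}. \<Sum>w\<in>N u \<inter> {a}. y u * y w)"
    proof (rule sum_arcs_le)
      show "\<exists>v\<in>Z. card (N v \<inter> (Z \<union> {a})) \<le> 1" if "Z \<subseteq> H" "Z \<noteq> {}" for Z
        using exists_leaf_off_hubs[OF V(1) no k U a RV cR RU] that by (simp add: H_def)
    qed (use fin aH M M0 x in \<open>auto simp: y_def H_def\<close>)
    moreover have "sum y H = sum x H" using aH by (intro sum.cong) (auto simp: y_def)
    moreover have "N a \<inter> {a} = {}" using irrefl by auto
    ultimately have le: "(\<Sum>u\<in>H \<union> {a}. \<Sum>w\<in>N u \<inter> (H \<union> {a}). y u * y w) \<le> 2 * M * sum x H"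
      by simp
    have "T3 + 2 * M * sum x R \<le> (\<Sum>u\<in>H \<union> {a}. \<Sum>w\<in>N u \<inter> (H \<union> {a}). y u * y w)"
    proof -
      have "(\<Sum>u\<in>R. M * x u) \<le> (\<Sum>w\<in>N a \<inter> (H \<union> {a}). y a * y w)"
      proof -
        have "(\<Sum>u\<in>R. M * x u) = (\<Sum>w\<in>R. y a * y w)"
          using aH by (intro sum.cong) (auto simp: y_def R_def H_def)
        also have "\<dots> \<le> (\<Sum>w\<in>N a \<inter> (H \<union> {a}). y a * y w)"
          using fin M0 x a sym by (intro sum_mono2) (auto simp: y_def R_def H_def)
        finally show ?thesis .
      qed
      moreover have "(\<Sum>w\<in>N u \<inter> H. x u * x w) + (if u \<in> R then M * x u else 0)
          \<le> (\<Sum>w\<in>N u \<inter> (H \<union> {a}). y u * y w)" if u: "u \<in> H" for u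
      proof -
        have e: "(\<Sum>w\<in>N u \<inter> H. x u * x w) = (\<Sum>w\<in>N u \<inter> H. y u * y w)"
          using aH u by (intro sum.cong) (auto simp: y_def)
        show ?thesis
        proof (cases "a \<in> N u")
          case True
          then have "N u \<inter> (H \<union> {a}) = insert a (N u \<inter> H)" by auto
          then have "(\<Sum>w\<in>N u \<inter> (H \<union> {a}). y u * y w) = y u * y a + (\<Sum>w\<in>N u \<inter> H. y u * y w)"
            using fin aH by simp
          moreover have "y u * y a = M * x u" using aH u by (auto simp: y_def)
          moreover have "0 \<le> M * x u" using M0 x[of u] u by (simp add: H_def)
          ultimately show ?thesis using e by simp
        next
          case False
          then have "u \<notin> R" "N u \<inter> (H \<union> {a}) = N u \<inter> H" using a by (auto simp: R_def)
          then show ?thesis using e by simp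
        qed
      qed
      then have "(\<Sum>u\<in>H. (\<Sum>w\<in>N u \<inter> H. x u * x w) + (if u \<in> R then M * x u else 0))
          \<le> (\<Sum>u\<in>H. \<Sum>w\<in>N u \<inter> (H \<union> {a}). y u * y w)" by (rule sum_mono)
      moreover have "(\<Sum>u\<in>H. if u \<in> R then M * x u else 0) = (\<Sum>u\<in>R. M * x u)"
      proof -
        have "H \<inter> R = R" by (auto simp: R_def H_def)
        then show ?thesis using fin by (simp add: sum.inter_restrict[symmetric])
      qed
      ultimately show ?thesis using fin aH
        by (simp add: sum.distrib T3_def sum_distrib_left[symmetric])
    qed
    moreover have "sum x H = sum x B + sum x R"
      using fin by (subst sum.subset_diff[of R H]) (auto simp: B_def R_def H_def)
    ultimately show ?thesis using le by (simp add: algebra_simps)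
  qed
  have xB: "0 \<le> sum x B" using x by (intro sum_nonneg) (auto simp: B_def H_def)
  have xx: "0 \<le> (\<Sum>v\<in>V. (x v)\<^sup>2)" by (intro sum_nonneg) auto
  have QS_r: "QS \<le> r * (\<Sum>v\<in>V. (x v)\<^sup>2)"
    unfolding QS_def S_def by (rule split_form_le(1)[OF V(1) U(1) refl n]) (use cU U r in auto)
  have "r * (\<Sum>v\<in>V. (x v)\<^sup>2) \<le> th * (\<Sum>v\<in>V. (x v)\<^sup>2)" using th xx by (intro mult_right_mono)
  moreover have lower: "2 * ((m0 - M) * sum x B) \<le> T1 + T2 - T3"
    using T2 T12 T3 by (simp add: algebra_simps)
  moreover have nn: "0 \<le> (m0 - M) * sum x B" using m0(1) xB by simp
  \<comment> \<open>\<open>QS\<close> is at most \<open>r\<close> times the square sum of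
    \<open>x\<close>, which is at most \<open>QG\<close>, while \<open>lower\<close> shows that
    \<open>QS\<close> is at least \<open>QG\<close>; so equality holds throughout.\<close>
  ultimately have QSeq: "QS = r * (\<Sum>v\<in>V. (x v)\<^sup>2)" "T1 + T2 - T3 = 0" "(m0 - M) * sum x B = 0"
    using QS_r QG_th diff by linarith+
  then have B0: "sum x B = 0" using m0(1) by simp
  \<comment> \<open>The equality case makes every entry off \<open>U\<close> positive too, so that a
    vanishing weighted sum has an empty range.\<close>
  have "r * x v = sum x U" if "v \<in> H" for v
    using split_form_le(2)[OF V(1) U(1) refl n, of r x v] QSeq(1) that cU U r
    unfolding QS_def S_def H_def by auto
  moreover have xU: "0 < x u" if "u \<in> U" for u using M(2)[OF that] M0 by simp
  then have "0 < sum x U" using a fin by (intro sum_pos) auto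
  ultimately have "0 < x v" if "v \<in> H" for v using that r(1) by (metis zero_less_mult_pos)
  then have xpos: "0 < x v" if "v \<in> V" for v using xU that by (auto simp: H_def)
  have "B = {}"
  proof (rule ccontr)
    assume "B \<noteq> {}"
    then have "0 < sum x B" using xpos fin by (intro sum_pos) (auto simp: B_def H_def)
    with B0 show False by simp
  qed
  then have HR: "H = R" by (auto simp: B_def R_def H_def)
  have T2z: "T2 = 0" unfolding T2_def HR by (intro sum.neutral ballI) (auto simp: R_def)
  have T1n: "0 \<le> T1" using T12 T2z by simp
  have T3n: "0 \<le> T3" unfolding T3_def using xpos
    by (intro sum_nonneg) (auto simp: H_def less_imp_le)
  have T3z: "T3 = 0" using T3 B0 T3n by simp
  have T1z: "T1 = 0" using QSeq(2) T2z T3z by simp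
  show ?thesis
  proof (cases "v \<in> U")
    case True
    have nonneg: "0 \<le> (\<Sum>w\<in>S u - N u. x u * x w)" if "u \<in> U" for u
      using xpos that U by (intro sum_nonneg) (auto simp: S_def less_imp_le)
    have "(\<Sum>w\<in>S v - N v. x v * x w) = 0"
      using T1z nonneg True fin unfolding T1_def by (subst (asm) sum_nonneg_eq_0_iff) auto
    have "S v - N v = {}"
    proof (rule ccontr)
      assume "S v - N v \<noteq> {}"
      then have "0 < (\<Sum>w\<in>S v - N v. x v * x w)"
        using V True U xpos by (intro sum_pos) (auto simp: S_def)
      then show False using \<open>(\<Sum>w\<in>S v - N v. x v * x w) = 0\<close> by simp
    qed
    then show ?thesis using True V(2)[of v] irrefl[of v] by (auto simp: S_def)
  next
    case False
    then have vH: "v \<in> H" using v by (simp add: H_def)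
    have nonneg: "0 \<le> (\<Sum>w\<in>N u \<inter> H. x u * x w)" if "u \<in> H" for u
      using xpos that by (intro sum_nonneg) (auto simp: H_def less_imp_le)
    have z: "(\<Sum>w\<in>N v \<inter> H. x v * x w) = 0"
      using T3z nonneg vH fin unfolding T3_def by (subst (asm) sum_nonneg_eq_0_iff) auto
    have "N v \<inter> H = {}"
    proof (rule ccontr)
      assume "N v \<inter> H \<noteq> {}"
      then have "0 < (\<Sum>w\<in>N v \<inter> H. x v * x w)"
        using fin vH xpos by (intro sum_pos) (auto simp: H_def)
      then show False using z by simp
    qed
    moreover have "U \<subseteq> N v" using vH HR by (simp add: R_def)
    ultimately show ?thesis using False V(2)[of v] by (auto simp: H_def)
  qed
qed

section \<open>The hubs of a graph with large eigenvalue\<close>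

text \<open>
  Here \<open>th\<close> is the eigenvalue, \<open>X\<close> the sum of the entries of a nonnegative eigenvector with maximum
  1, and every subgraph has a vertex of degree at most \<open>d\<close>. The factor 230400 is \<open>16 \<cdot> 120\<^sup>2\<close>.
\<close>

locale estimates =
  fixes K S n th d X :: real
  assumes K: "1 \<le> K" and S: "S = 2 * K - 1" and n: "230400 * K ^ 4 * S \<le> n"
    and th0: "0 < th" and th: "S * (n - S) \<le> th\<^sup>2"
    and d: "1 \<le> d" "d \<le> 3 / 2 * S"
    and X: "0 \<le> X" "th * X \<le> d * (n + X)" "th\<^sup>2 \<le> d * (n + X)"
begin

lemma S1: "1 \<le> S" and S2: "S \<le> 2 * K" and K2: "1 \<le> K\<^sup>2"
  using K S by auto

text \<open>\<open>230400 = 480^2\<close>; lowering 480 to 479 absorbs the \<open>S\<close>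
  subtracted in \<open>S * (n - S)\<close>.\<close>

lemma th_ge: "479 * K\<^sup>2 * S \<le> th"
proof (rule power2_le_imp_le)
  have K4: "1 \<le> K ^ 4" using K by simp
  have "(479 * K\<^sup>2 * S)\<^sup>2 = 229441 * K ^ 4 * S\<^sup>2" by (simp add: power_mult_distrib)
  also have "\<dots> \<le> 230400 * K ^ 4 * S\<^sup>2 - 1 * S\<^sup>2"
  proof -
    have "1 * S\<^sup>2 \<le> K ^ 4 * S\<^sup>2" using K4 by (intro mult_right_mono) auto
    moreover have "0 \<le> S\<^sup>2" by simp
    ultimately show ?thesis by linarith
  qed
  also have "\<dots> = S * (230400 * K ^ 4 * S - S)" by (simp add: power2_eq_square algebra_simps)
  also have "\<dots> \<le> S * (n - S)" using n S1 by (intro mult_left_mono) auto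
  also have "\<dots> \<le> th\<^sup>2" by (rule th)
  finally show "(479 * K\<^sup>2 * S)\<^sup>2 \<le> th\<^sup>2" .
qed (use th0 in simp)

lemma th_ge_S: "479 * S \<le> th"
proof -
  have "479 * S * 1 \<le> 479 * S * K\<^sup>2" using K2 S1 by (intro mult_left_mono) auto
  then show ?thesis using th_ge by (simp add: mult_ac)
qed

text \<open>\<open>3 / 2 * (1 + 1 / 150) = 151 / 100\<close>, where \<open>th^2 / 150\<close> bounds
  the correction \<open>S^2\<close> between \<open>S * n\<close> and
  \<open>S * (n - S)\<close>.\<close>

lemma dn_le: "d * n \<le> 151 / 100 * th\<^sup>2"
proof -
  have "0 \<le> n" using n K S1 by (smt (verit) mult_nonneg_nonneg zero_le_power)
  then have "d * n \<le> 3 / 2 * S * n" using d by (intro mult_right_mono) auto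
  also have "\<dots> = 3 / 2 * (S * (n - S) + S\<^sup>2)" by (simp add: algebra_simps power2_eq_square)
  also have "\<dots> \<le> 3 / 2 * (th\<^sup>2 + S\<^sup>2)" using th by simp
  also have "S\<^sup>2 \<le> (th / 479)\<^sup>2" using th_ge_S S1 by (intro power_mono) auto
  then have "S\<^sup>2 * 229441 \<le> th\<^sup>2" by (simp add: power_divide)
  then have "S\<^sup>2 * 150 \<le> th\<^sup>2" by (rule order_trans[rotated]) (intro mult_left_mono, auto)
  then have "3 / 2 * (th\<^sup>2 + S\<^sup>2) \<le> 151 / 100 * th\<^sup>2" by simp
  finally show ?thesis .
qed

lemma d_le: "d \<le> th / 300" "d * th \<le> th\<^sup>2 / 300"
proof -
  show "d \<le> th / 300" using d th_ge_S by simp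
  then show "d * th \<le> th\<^sup>2 / 300" using mult_right_mono[of d "th / 300" th] th0
    by (simp add: power2_eq_square)
qed

text \<open>The inequality for \<open>th * X\<close> rearranges to
  \<open>X * (th - d) \<le> d * n\<close>, whose right side is at most
  \<open>151 / 100 * th^2\<close>, and \<open>d\<close> is negligible against
  \<open>th\<close>.\<close>

lemma X_le: "X \<le> 8 / 5 * th"
proof (rule ccontr)
  assume "\<not> ?thesis"
  then have "8 / 5 * th * (th - d) < X * (th - d)" using d_le th0 by (intro mult_strict_right_mono) auto
  also have "\<dots> \<le> d * n" using X by (simp add: algebra_simps)
  finally have "8 / 5 * th\<^sup>2 - 8 / 5 * (d * th) < d * n" by (simp add: algebra_simps power2_eq_square)
  moreover have "0 < th\<^sup>2" using th0 by simp
  ultimately show False using dn_le d_le by linarith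
qed

text \<open>\<open>D\<close> will be the degree of a vertex with entry at least
  \<open>1 / (40 * K^2)\<close>. Since \<open>479 / 40 * S\<close> exceeds
  \<open>79 / 10 * d\<close>, the sum \<open>D + X\<close> is at least \<open>79 / 10 * th\<close>,
  of which \<open>X\<close> takes at most \<open>8 / 5 * th\<close>.\<close>

lemma deg_ge:
  assumes "th\<^sup>2 * (1 / (40 * K\<^sup>2)) \<le> d * (D + X)"
  shows "63 / 10 * th \<le> D"
proof -
  have "479 * S / 40 \<le> th * (1 / (40 * K\<^sup>2))"
    using th_ge K by (simp add: field_simps)
  then have "79 / 10 * d \<le> th * (1 / (40 * K\<^sup>2))" using d by simp
  then have "th * (79 / 10 * d) \<le> th * (th * (1 / (40 * K\<^sup>2)))" using th0 by (intro mult_left_mono) auto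
  also have "\<dots> \<le> d * (D + X)" using assms by (simp add: power2_eq_square)
  finally have "d * (79 / 10 * th) \<le> d * (D + X)" by (simp add: mult_ac)
  then have "79 / 10 * th \<le> D + X" using d by simp
  then show ?thesis using X_le by simp
qed

text \<open>\<open>l\<close> will be the number of such vertices. More than \<open>th / 4\<close> of
  them would have total degree above \<open>63 / 40 * th^2\<close>, too much for the bound
  \<open>151 / 100 * th^2\<close> on \<open>d * n\<close>.\<close>

lemma large_le:
  assumes "0 \<le> l" "l * (63 / 10 * th) \<le> d * (l + n)"
  shows "l \<le> th / 4"
proof (rule ccontr)
  assume "\<not> ?thesis"
  then have "th / 4 * (63 / 10 * th - d) < l * (63 / 10 * th - d)"
    using d_le th0 by (intro mult_strict_right_mono) auto
  also have "\<dots> \<le> d * n" using assms by (simp add: algebra_simps)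
  finally have "63 / 40 * th\<^sup>2 - 1 / 4 * (d * th) < d * n" by (simp add: algebra_simps power2_eq_square)
  moreover have "0 < th\<^sup>2" using th0 by simp
  ultimately show False using dn_le d_le by linarith
qed

text \<open>The left side is the total error when hubs are located. Its main part,
  \<open>d * n / (40 * K^2)\<close>, is at most \<open>3 / 40 * n / K\<close>; the other terms are
  of order \<open>S * th\<close>, which is small because \<open>K^2 * th\<close> is below
  \<open>n / 300\<close>.\<close>

lemma loss_le:
  assumes l: "l \<le> th / 4"
  shows "S\<^sup>2 + 3 * d * l + d * (1 / (40 * K\<^sup>2) * n + X) \<le> n / (9 * K)"
proof -
  have n0: "0 \<le> n" using n K S1 by (smt (verit) mult_nonneg_nonneg zero_le_power)
  have "d * X \<le> 3 / 2 * S * (8 / 5 * th)" using d X_le X S1 by (intro mult_mono) auto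
  then have dX: "d * X \<le> 12 / 5 * (S * th)" by simp
  have dn: "d * n \<le> 3 / 2 * S * n" using d n0 by (intro mult_right_mono) auto
  have "479 * K\<^sup>2 * S * th \<le> th * th" using th_ge th0 by (intro mult_right_mono) auto
  also have "\<dots> \<le> 3 / 2 * S * n + 12 / 5 * (S * th)"
    using X(3) dX dn by (simp add: power2_eq_square algebra_simps)
  finally have "S * (479 * K\<^sup>2 * th) \<le> S * (3 / 2 * n + 12 / 5 * th)" by (simp add: algebra_simps)
  then have "479 * (K\<^sup>2 * th) \<le> 3 / 2 * n + 12 / 5 * th" using S1 by simp
  moreover have "1 * th \<le> K\<^sup>2 * th" using K2 th0 by (intro mult_right_mono) auto
  ultimately have thn: "K\<^sup>2 * th \<le> 316 / 100000 * n" using n0 by linarith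
  have "3 * d * l \<le> 3 * d * (th / 4)" using l d by (intro mult_left_mono) auto
  also have "\<dots> \<le> 3 * (3 / 2 * S) * (th / 4)" using d th0 by (intro mult_right_mono) auto
  finally have a: "3 * d * l \<le> 9 / 8 * (S * th)" by simp
  have "S * S \<le> S * (th / 479)" using th_ge_S S1 by (intro mult_left_mono) auto
  then have b: "S\<^sup>2 \<le> 1 / 479 * (S * th)" by (simp add: power2_eq_square)
  have c: "d * (1 / (40 * K\<^sup>2) * n) \<le> 3 / 2 * S * (1 / (40 * K\<^sup>2) * n)"
    using d n0 by (intro mult_right_mono) auto
  define T where "T = S\<^sup>2 + 3 * d * l + d * (1 / (40 * K\<^sup>2) * n + X)"
  have "T \<le> 353 / 100 * (S * th) + 3 / 2 * S * (1 / (40 * K\<^sup>2) * n)"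
  proof -
    have "0 \<le> S * th" using S1 th0 by simp
    then show ?thesis using a b c dX unfolding T_def distrib_left by linarith
  qed
  then have "K\<^sup>2 * T \<le> K\<^sup>2 * (353 / 100 * (S * th) + 3 / 2 * S * (1 / (40 * K\<^sup>2) * n))"
    by (intro mult_left_mono) auto
  also have "\<dots> = S * (353 / 100 * (K\<^sup>2 * th) + 3 / 80 * n)"
    using K by (simp add: field_simps)
  also have "\<dots> \<le> S * (1 / 20 * n)"
  proof (rule mult_left_mono)
    show "353 / 100 * (K\<^sup>2 * th) + 3 / 80 * n \<le> 1 / 20 * n" using thn n0 by linarith
  qed (use S1 in simp)
  also have "\<dots> \<le> 2 * K * (1 / 20 * n)" using S2 n0 by (intro mult_right_mono) auto
  finally have "K * (K * T) \<le> K * (1 / 10 * n)" by (simp add: power2_eq_square algebra_simps)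
  then have "K * T \<le> 1 / 10 * n" using K by simp
  then have "T \<le> 1 / 10 * n / K" using K by (simp add: pos_le_divide_eq mult_ac)
  also have "\<dots> \<le> n / (9 * K)" using K n0 by (simp add: field_simps)
  finally show ?thesis unfolding T_def .
qed

end

context nbhd
begin

text \<open>Applying the eigenvalue equation twice at \<open>u0\<close> writes \<open>th^2\<close>
  as a sum over the neighbours of \<open>u0\<close>. Up to a total error \<open>Lam\<close>, each
  contributes at most \<open>S\<close>, through its own neighbours in \<open>L\<close>; since
  \<open>th^2\<close> is at least \<open>S * (n - S)\<close>, most vertices come within
  \<open>sg\<close> of \<open>S\<close>.\<close>

lemma large_eigenvalue_hubs:
  fixes x :: "'a \<Rightarrow> real" and th :: real
  assumes V: "finite V" "\<And>v. N v \<subseteq> V" "card V = n" and no: "\<not> disjoint_cycles N k V" and k: "1 \<le> k"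
    and n: "230400 * real k ^ 4 * (2 * real k - 1) \<le> real n"
    and x: "\<And>v. v \<in> V \<Longrightarrow> 0 \<le> x v \<and> x v \<le> 1" and u0: "u0 \<in> V" "x u0 = 1"
    and th: "0 < th" "(2 * real k - 1) * (real n - (2 * real k - 1)) \<le> th\<^sup>2"
    and eig: "\<And>v. v \<in> V \<Longrightarrow> (\<Sum>w\<in>N v. x w) = th * x v"
  defines "U \<equiv> {v \<in> V. 1 - 1 / (4 * real k) \<le> x v}"
  shows "card U = 2 * k - 1" and "2 * k + 3 \<le> card {w \<in> V - U. U \<subseteq> N w}"
proof -
  define K where "K = real k"
  define S where "S = 2 * K - 1"
  define d where "d = 3 * k - 2"
  define X where "X = sum x V"
  \<comment> \<open>\<open>eps\<close> separates the large entries \<open>L\<close> from the rest;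
    \<open>sg\<close> is the tolerance both for the entry at a hub and for the weight that a vertex
    of \<open>Gd\<close> sees in \<open>L\<close>.\<close>
  define eps where "eps = 1 / (40 * K\<^sup>2)"
  define sg where "sg = 1 / (4 * K)"
  have K1: "1 \<le> K" using k by (simp add: K_def)
  have Snat: "S = real (2 * k - 1)" using k by (simp add: S_def K_def of_nat_diff)
  have S1: "1 \<le> S" using K1 by (simp add: S_def)
  have sg: "0 < sg" "sg < 1" using K1 by (auto simp: sg_def field_simps)
  have finN: "finite (N v)" for v using finite_subset[OF V(2) V(1)] .
  have NV: "N v \<inter> V = N v" for v using V(2) by blast
  have deg: "\<exists>v\<in>Z. card (N v \<inter> Z) \<le> d" if "Z \<subseteq> V" "Z \<noteq> {}" for Z
    using exists_small_degree[OF V(1) no that k] by (simp add: d_def)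
  have arcs: "(\<Sum>u\<in>V. \<Sum>w\<in>N u. f u * g w) \<le> real d * (Mg * sum f V + Mf * sum g V)"
    if "\<And>v. v \<in> V \<Longrightarrow> 0 \<le> f v \<and> f v \<le> Mf" "\<And>v. v \<in> V \<Longrightarrow> 0 \<le> g v \<and> g v \<le> Mg"
    for f g :: "'a \<Rightarrow> real" and Mf Mg
  proof -
    have "(\<Sum>u\<in>V. \<Sum>w\<in>N u \<inter> V. f u * g w) \<le> real d * (Mg * sum f V + Mf * sum g V)"
      by (rule sum_arcs_le_degenerate[OF V(1)]) (fact deg that)+
    then show ?thesis by (simp only: NV)
  qed
  have degs: "(\<Sum>u\<in>A. card (N u \<inter> B)) \<le> d * (card A + card B)" if "A \<subseteq> V" "B \<subseteq> V" for A B
    by (rule sum_degree_le_degenerate[OF V(1)]) (fact deg that)+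
  have walk: "(\<Sum>w\<in>Y. \<Sum>z\<in>N w. x z) = th * (\<Sum>w\<in>Y. x w)" if "Y \<subseteq> V" for Y
    using that eig by (auto simp: sum_distrib_left intro!: sum.cong)
  have two: "(\<Sum>w\<in>N v. \<Sum>z\<in>N w. x z) = th\<^sup>2 * x v" if "v \<in> V" for v
    using walk[OF V(2)] eig[OF that] by (simp add: power2_eq_square)
  have X0: "0 \<le> X" unfolding X_def using x by (intro sum_nonneg) auto
  have "(\<Sum>w\<in>V. \<Sum>z\<in>N w. 1 * x z) \<le> real d * (1 * (\<Sum>w\<in>V. 1) + 1 * sum x V)"
    by (rule arcs) (use x in auto)
  then have Xle: "th * X \<le> real d * (real n + X)" using walk[of V] V(3) by (simp add: X_def)
  have deg_x: "th\<^sup>2 * x v \<le> real d * (real (card (N v)) + X)" if "v \<in> V" for v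
  proof -
    have "(\<Sum>w\<in>V. \<Sum>z\<in>N w. of_bool (w \<in> N v) * x z)
      \<le> real d * (1 * (\<Sum>w\<in>V. of_bool (w \<in> N v)) + 1 * sum x V)"
      by (rule arcs) (use x in auto)
    also have "(\<Sum>w\<in>V. of_bool (w \<in> N v)) = real (card (N v))"
      using V by (simp add: inf.absorb2)
    also have "(\<Sum>w\<in>V. \<Sum>z\<in>N w. of_bool (w \<in> N v) * x z) = (\<Sum>w\<in>N v. \<Sum>z\<in>N w. x z)"
      by (rule sum.mono_neutral_cong_right) (use V in auto)
    finally show ?thesis using two[OF that] by (simp add: X_def)
  qed
  have degn: "real (card (N v)) \<le> real n" for v using card_mono[OF V(1) V(2)] V(3) by simp
  interpret estimates K S "real n" th "real d" X
  proof
    show "230400 * K ^ 4 * S \<le> real n" using n by (simp add: K_def S_def)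
    show "S * (real n - S) \<le> th\<^sup>2" using th(2) by (simp add: K_def S_def)
    show "1 \<le> real d" "real d \<le> 3 / 2 * S" using k by (auto simp: d_def S_def K_def of_nat_diff)
    have "th\<^sup>2 \<le> real d * (real (card (N u0)) + X)" using deg_x[OF u0(1)] u0(2) by simp
    also have "\<dots> \<le> real d * (real n + X)" using degn by (intro mult_left_mono) auto
    finally show "th\<^sup>2 \<le> real d * (real n + X)" .
  qed (use K1 S_def th X0 Xle in auto)

  \<comment> \<open>Vertices with a large entry\<close>
  define L where "L = {v \<in> V. eps \<le> x v}"
  have L: "L \<subseteq> V" "finite L" using V by (auto simp: L_def)
  define l where "l = real (card L)"
  have Ldeg: "63 / 10 * th \<le> real (card (N v))" if "v \<in> L" for v
  proof (rule deg_ge)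
    have "th\<^sup>2 * (1 / (40 * K\<^sup>2)) \<le> th\<^sup>2 * x v"
      using that by (intro mult_left_mono) (auto simp: L_def eps_def)
    also have "\<dots> \<le> real d * (real (card (N v)) + X)" using deg_x that L by auto
    finally show "th\<^sup>2 * (1 / (40 * K\<^sup>2)) \<le> real d * (real (card (N v)) + X)" .
  qed
  have l: "l \<le> th / 4"
  proof (rule large_le)
    have "l * (63 / 10 * th) \<le> (\<Sum>v\<in>L. real (card (N v)))"
      unfolding l_def using Ldeg by (intro sum_bounded_below) auto
    also have "\<dots> = real (\<Sum>v\<in>L. card (N v \<inter> V))" by (simp add: NV)
    also have "\<dots> \<le> real (d * (card L + card V))" using degs[OF L(1) subset_refl] by (rule of_nat_mono)
    finally show "l * (63 / 10 * th) \<le> real d * (l + real n)" by (simp add: l_def V(3))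
  qed (simp add: l_def)
  define W where "W = {w \<in> V - L. 2 * k \<le> card (N w \<inter> L)}"
  have W: "card W \<le> card L"
  proof (rule ccontr)
    assume "\<not> ?thesis"
    then have "disjoint_cycles N k (W \<union> L)"
      using V(1) L by (intro disjoint_cycles_bipartite) (auto simp: W_def)
    then have "disjoint_cycles N k V" by (rule disjoint_cycles_mono) (use L in \<open>auto simp: W_def\<close>)
    with no show False ..
  qed
  \<comment> \<open>\<open>W \<union> L\<close> is so small that bounding \<open>SL\<close> there by the number of arcs into \<open>L\<close> is affordable.\<close>
  define Bd where "Bd = W \<union> L"
  have Bd: "Bd \<subseteq> V" "finite Bd" using L V(1) by (auto simp: Bd_def W_def)
  have cBd: "real (card Bd) \<le> 2 * l" using W card_Un_le[of W L] by (simp add: Bd_def l_def)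
  define SL where "SL w = (\<Sum>z\<in>N w \<inter> L. x z)" for w
  have SLcard: "SL w \<le> real (card (N w \<inter> L))" for w
    unfolding SL_def using x L by (intro order_trans[OF sum_bounded_above[of _ _ 1]]) auto
  have SL0: "0 \<le> SL w" for w unfolding SL_def using x L by (intro sum_nonneg) auto
  have few: "card (N w \<inter> L) \<le> 2 * k - 1" if "w \<in> V - Bd" for w
    using that by (auto simp: Bd_def W_def)
  have SL_S: "SL w \<le> S" if "w \<in> V - Bd" for w
  proof -
    have "real (card (N w \<inter> L)) \<le> S" unfolding Snat using few[OF that] by (rule of_nat_mono)
    then show ?thesis using SLcard[of w] by linarith
  qed
  \<comment> \<open>The first part bounds \<open>SL\<close> on \<open>Bd\<close>, where
    \<open>card Bd + card L\<close> is at most \<open>3 * l\<close>. The second bounds the entries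
    off \<open>L\<close>, for which \<open>eps\<close> replaces 1 as the maximum in
    \<open>arcs\<close>.\<close>
  define Lam where "Lam = 3 * real d * l + real d * (eps * real n + X)"
  have Lam: "S\<^sup>2 + Lam \<le> real n / (9 * K)" using loss_le[OF l] by (simp add: Lam_def eps_def)
  have main: "(\<Sum>w\<in>Y. \<Sum>z\<in>N w. x z) \<le> (\<Sum>w\<in>Y - Bd. SL w) + Lam" if Y: "Y \<subseteq> V" for Y
  proof -
    have finY: "finite Y" using finite_subset[OF Y V(1)] .
    have "(\<Sum>w\<in>Y. \<Sum>z\<in>N w. x z) = (\<Sum>w\<in>Y. SL w) + (\<Sum>w\<in>Y. \<Sum>z\<in>N w - L. x z)"
      unfolding SL_def sum.distrib[symmetric]
      by (intro sum.cong refl) (simp add: sum.Int_Diff[OF finN, symmetric])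
    moreover have "(\<Sum>w\<in>Y. SL w) = (\<Sum>w\<in>Y \<inter> Bd. SL w) + (\<Sum>w\<in>Y - Bd. SL w)"
      using sum.Int_Diff[OF finY] .
    moreover have "(\<Sum>w\<in>Y \<inter> Bd. SL w) \<le> 3 * real d * l"
    proof -
      have "(\<Sum>w\<in>Y \<inter> Bd. SL w) \<le> (\<Sum>w\<in>Bd. SL w)" using Bd SL0 by (intro sum_mono2) auto
      also have "\<dots> \<le> (\<Sum>w\<in>Bd. real (card (N w \<inter> L)))" using SLcard by (rule sum_mono)
      also have "\<dots> = real (\<Sum>w\<in>Bd. card (N w \<inter> L))" by simp
      also have "\<dots> \<le> real (d * (card Bd + card L))" using degs[OF Bd(1) L(1)] by (rule of_nat_mono)
      also have "\<dots> \<le> real d * (3 * l)" unfolding of_nat_mult using cBd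
        by (intro mult_left_mono) (auto simp: l_def)
      finally show ?thesis by simp
    qed
    moreover have "(\<Sum>w\<in>Y. \<Sum>z\<in>N w - L. x z) \<le> real d * (eps * real n + X)"
    proof -
      define g where "g z = (if z \<in> L then 0 else x z)" for z
      have "(\<Sum>w\<in>Y. \<Sum>z\<in>N w - L. x z) = (\<Sum>w\<in>Y. \<Sum>z\<in>N w. g z)"
        unfolding g_def using finN by (intro sum.cong refl sum.mono_neutral_cong_left) auto
      also have "\<dots> \<le> (\<Sum>w\<in>V. \<Sum>z\<in>N w. 1 * g z)"
        unfolding g_def using x Y V by (simp, intro sum_mono2 sum_nonneg) auto
      also have "\<dots> \<le> real d * (eps * (\<Sum>w\<in>V. 1) + 1 * sum g V)"
        by (rule arcs) (use x in \<open>auto simp: g_def L_def eps_def\<close>)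
      also have "\<dots> \<le> real d * (eps * real n + X)"
        unfolding X_def g_def using V(3) x
        by (intro mult_left_mono) (auto intro!: sum_mono)
      finally show ?thesis .
    qed
    ultimately show ?thesis by (simp add: Lam_def)
  qed

  \<comment> \<open>Hubs and their common neighbours\<close>
  define Gd where "Gd = {w \<in> V - Bd. S - sg \<le> SL w}"
  have Gd: "Gd \<subseteq> V" "finite Gd" using V(1) by (auto simp: Gd_def)
  \<comment> \<open>Each vertex outside \<open>Gd\<close> loses at least \<open>sg\<close> against
    the maximum \<open>S\<close>. The total loss is at most \<open>n / (9 * K)\<close>, so with
    \<open>sg = 1 / (4 * K)\<close> there are at most \<open>4 / 9 * n\<close> of them.\<close>
  have cGd: "5 / 9 * real n \<le> real (card Gd)"
  proof -
    have "th\<^sup>2 \<le> (\<Sum>w\<in>N u0 - Bd. SL w) + Lam" using main[OF V(2)[of u0]] two[OF u0(1)] u0(2) by simp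
    also have "(\<Sum>w\<in>N u0 - Bd. SL w) \<le> (\<Sum>w\<in>V - Bd. SL w)"
      using V SL0 by (intro sum_mono2) auto
    also have "\<dots> \<le> (\<Sum>w\<in>V - Bd. (S - sg) + sg * of_bool (w \<in> Gd))"
      using SL_S by (intro sum_mono) (auto simp: Gd_def)
    also have "\<dots> \<le> (\<Sum>w\<in>V. (S - sg) + sg * of_bool (w \<in> Gd))"
      using V S1 sg by (intro sum_mono2) auto
    also have "\<dots> = (S - sg) * real n + sg * real (card Gd)"
      using V Gd by (simp add: sum.distrib sum_distrib_left[symmetric] inf.absorb2)
    finally have "sg * (real n - real (card Gd)) \<le> S * real n - th\<^sup>2 + Lam" by (simp add: algebra_simps)
    also have "\<dots> \<le> S\<^sup>2 + Lam" using local.th by (simp add: power2_eq_square algebra_simps)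
    also note Lam
    finally have "real n - real (card Gd) \<le> 4 / 9 * real n" using K1 by (simp add: sg_def field_simps)
    then show ?thesis by simp
  qed
  \<comment> \<open>\<open>5 / 18\<close> of the vertices are left when each of \<open>2 * k\<close>
    hubs misses \<open>13 / 36 * n / K\<close>; this share is also below the share
    \<open>5 / 9\<close> of \<open>Gd\<close>.\<close>
  have n18: "2 * K + 3 < 5 / 18 * real n"
  proof -
    have "1 \<le> K ^ 3" using K1 by simp
    then have "230400 * K * (1 * 1) \<le> 230400 * K * (K ^ 3 * S)"
      using S1 K1 by (intro mult_left_mono mult_mono) auto
    also have "\<dots> = 230400 * K ^ 4 * S" by (simp add: power_numeral_reduce)
    also have "\<dots> \<le> real n" using n by (simp add: K_def S_def)
    finally show ?thesis using K1 by simp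
  qed
  have U: "U \<subseteq> V" "finite U" using V(1) by (auto simp: U_def)
  \<comment> \<open>\<open>S\<close> is an integer and \<open>sg < 1\<close>, so \<open>w\<close>
    has at least \<open>2 * k - 1\<close> neighbours in \<open>L\<close>. It has no more, and
    entries are at most 1, so each of them must reach \<open>1 - sg\<close>.\<close>
  have GdU: "2 * k - 1 \<le> card (N w \<inter> L)" "N w \<inter> L \<subseteq> U" if w: "w \<in> Gd" for w
  proof -
    have wB: "w \<in> V - Bd" and SLw: "S - sg \<le> SL w" using w by (auto simp: Gd_def)
    have "S - sg \<le> real (card (N w \<inter> L))" using SLw SLcard[of w] by linarith
    then have "real (2 * k - 1) < real (card (N w \<inter> L) + 1)" using sg unfolding Snat by simp
    then show c: "2 * k - 1 \<le> card (N w \<inter> L)" by linarith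
    show "N w \<inter> L \<subseteq> U"
    proof
      fix z assume z: "z \<in> N w \<inter> L"
      have "SL w = x z + (\<Sum>z'\<in>N w \<inter> L - {z}. x z')"
        unfolding SL_def using z finN by (intro sum.remove) auto
      also have "(\<Sum>z'\<in>N w \<inter> L - {z}. x z') \<le> real (card (N w \<inter> L - {z})) * 1"
        using x L by (intro sum_bounded_above) auto
      also have "\<dots> \<le> S - 1"
        using few[OF wB] z finN k by (simp add: Snat of_nat_diff)
      finally have "1 - sg \<le> x z" using SLw by simp
      then show "z \<in> U" using z L by (auto simp: U_def sg_def K_def)
    qed
  qed
  \<comment> \<open>The argument for \<open>u0\<close>, run at \<open>v\<close> with entry at least
    \<open>1 - sg\<close>: the losses \<open>1 / 4\<close> from \<open>sg\<close> and
    \<open>1 / 9\<close> from \<open>Lam\<close>, both over \<open>K\<close>, add up to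
    \<open>13 / 36\<close>.\<close>
  have Umiss: "real n - real (card (N v)) \<le> 13 / 36 * real n / K" if v: "v \<in> U" for v
  proof -
    have "th\<^sup>2 * (1 - sg) \<le> th\<^sup>2 * x v"
      using v by (intro mult_left_mono) (auto simp: U_def sg_def K_def)
    also have "\<dots> \<le> (\<Sum>w\<in>N v - Bd. SL w) + Lam" using main[OF V(2)[of v]] two v U by auto
    also have "(\<Sum>w\<in>N v - Bd. SL w) \<le> real (card (N v - Bd)) * S"
      using SL_S V(2)[of v] by (intro sum_bounded_above) auto
    also have "\<dots> \<le> real (card (N v)) * S"
      using S1 finN by (intro mult_right_mono of_nat_mono card_mono) auto
    finally have 1: "th\<^sup>2 * (1 - sg) \<le> real (card (N v)) * S + Lam" by simp
    have "(S * real n - S\<^sup>2) * (1 - sg) \<le> th\<^sup>2 * (1 - sg)"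
      using local.th sg by (intro mult_right_mono) (auto simp: power2_eq_square algebra_simps)
    moreover have "0 \<le> S\<^sup>2 * sg" using sg by simp
    ultimately have "S * (real n - real (card (N v))) \<le> sg * S * real n + (S\<^sup>2 + Lam)"
      using 1 by (simp add: algebra_simps)
    also have "S\<^sup>2 + Lam \<le> S * (real n / (9 * K))"
    proof -
      have "1 * (real n / (9 * K)) \<le> S * (real n / (9 * K))"
        using S1 K1 by (intro mult_right_mono) auto
      then show ?thesis using Lam by simp
    qed
    finally have "S * (real n - real (card (N v))) \<le> S * (sg * real n + real n / (9 * K))"
      by (simp add: algebra_simps)
    then have "real n - real (card (N v)) \<le> sg * real n + real n / (9 * K)" using S1 by simp
    also have "\<dots> = 13 / 36 * real n / K" using K1 by (simp add: sg_def field_simps)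
    finally show ?thesis .
  qed
  have Ule: "card U \<le> 2 * k - 1"
  proof (rule ccontr)
    assume "\<not> ?thesis"
    then have "2 * k \<le> card U" by simp
    then obtain P where P: "P \<subseteq> U" "card P = 2 * k" "finite P"
      using obtain_subset_with_card_n by metis
    \<comment> \<open>By \<open>n18\<close> more than \<open>2 * k\<close> vertices are adjacent to
      all of \<open>P\<close>, which gives \<open>k\<close> disjoint cycles between \<open>Q\<close>
      and \<open>P\<close>.\<close>
    define Q where "Q = {w \<in> V. P \<subseteq> N w}"
    have "V - Q \<subseteq> (\<Union>v\<in>P. V - N v)" using sym by (auto simp: Q_def)
    then have "card (V - Q) \<le> card (\<Union>v\<in>P. V - N v)" using P V(1) by (intro card_mono) auto
    also have "\<dots> \<le> (\<Sum>v\<in>P. card (V - N v))" using P by (intro card_UN_le)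
    finally have "real (card (V - Q)) \<le> real (\<Sum>v\<in>P. card (V - N v))" by (rule of_nat_mono)
    also have "\<dots> = (\<Sum>v\<in>P. real n - real (card (N v)))"
      using V finN degn by (simp add: card_Diff_subset of_nat_diff)
    also have "\<dots> \<le> real (card P) * (13 / 36 * real n / K)"
      using Umiss P by (intro sum_bounded_above) auto
    also have "\<dots> = 13 / 18 * real n" using P K1 by (simp add: K_def)
    finally have "real (card (V - Q)) \<le> 13 / 18 * real n" .
    moreover have "real (card (V - Q)) = real n - real (card Q)"
    proof -
      have "Q \<subseteq> V" "finite Q" using V(1) by (auto simp: Q_def)
      then show ?thesis using V(3) card_mono[OF V(1), of Q] by (simp add: card_Diff_subset of_nat_diff)
    qed
    ultimately have "2 * K < real (card Q)" using n18 by simp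
    then have "card P < card Q" unfolding P(2) K_def by linarith
    moreover have "Q \<inter> P = {}" using irrefl by (auto simp: Q_def)
    moreover have "card (N w \<inter> P) = 2 * k" if "w \<in> Q" for w
      using that P(2) by (simp add: Q_def inf.absorb2)
    ultimately have "disjoint_cycles N k (Q \<union> P)"
      using P V(1) by (intro disjoint_cycles_bipartite) (auto simp: Q_def)
    then have "disjoint_cycles N k V" by (rule disjoint_cycles_mono) (use P U in \<open>auto simp: Q_def\<close>)
    with no show False ..
  qed
  \<comment> \<open>A vertex of \<open>Gd\<close> sees at least \<open>2 * k - 1\<close> members of
    \<open>U\<close>, and by \<open>Ule\<close> there are no others.\<close>
  have full: "card U = 2 * k - 1 \<and> U \<subseteq> N w" if "w \<in> Gd" for w
  proof -
    have "card (N w \<inter> L) = card U" "card U = 2 * k - 1"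
      using GdU[OF that] Ule card_mono[OF U(2) GdU(2)[OF that]] by auto
    then have "N w \<inter> L = U" using card_subset_eq[OF U(2) GdU(2)[OF that]] by simp
    then show ?thesis using \<open>card U = 2 * k - 1\<close> by blast
  qed
  have "real (2 * k + 3) < real (card Gd)" using cGd n18 by (simp add: K_def)
  then have c: "2 * k + 3 < card Gd" by (simp only: of_nat_less_iff)
  then obtain w where "w \<in> Gd" by fastforce
  then show "card U = 2 * k - 1" using full by blast
  have "Gd \<subseteq> {w \<in> V - U. U \<subseteq> N w}" using full Gd irrefl by blast
  then have "card Gd \<le> card {w \<in> V - U. U \<subseteq> N w}" using V(1) by (intro card_mono) auto
  then show "2 * k + 3 \<le> card {w \<in> V - U. U \<subseteq> N w}" using c by simp
qed

end

section \<open>The spectral radius of a graph\<close>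

definition nbrs :: "'a pair_pre_digraph \<Rightarrow> 'a \<Rightarrow> 'a set" where
  "nbrs G v = {w. (v, w) \<in> parcs G}"

lemma (in pair_graph) nbrs_subset: "nbrs G v \<subseteq> pverts G"
  by (auto simp: nbrs_def dest: wellformed')

lemma (in pair_graph) nbhd_nbrs: "nbhd (nbrs G)"
  by unfold_locales (auto simp: nbrs_def dest: arcs_symmetric no_loops')

text \<open>Eigenvectors indexed by an enumeration become functions on the vertices, so that
  spectral arguments can use sums over neighbours.\<close>

lemma eigenvalue_adjacency_matrix_wrt_iff:
  assumes vs: "distinct vs" "set vs = pverts G" and "pair_graph G"
  shows "eigenvalue (adjacency_matrix_wrt vs G) e \<longleftrightarrow>
    (\<exists>f. (\<exists>v\<in>pverts G. f v \<noteq> 0) \<and> (\<forall>v\<in>pverts G. (\<Sum>w\<in>nbrs G v. f w) = e * f v))"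
proof -
  interpret pair_graph G by fact
  define n where "n = length vs"
  let ?A = "adjacency_matrix_wrt vs G"
  have bij: "bij_betw ((!) vs) {..<n} (pverts G)"
    using vs bij_betw_nth[OF vs(1)] by (simp add: n_def)
  have nthV: "vs ! i \<in> pverts G" if "i < n" for i
    using nth_mem[of i vs] that by (simp only: vs(2) n_def)
  have idx: "\<exists>i<n. u = vs ! i" if "u \<in> pverts G" for u
    using that unfolding vs(2)[symmetric] by (auto simp: n_def in_set_conv_nth)
  have row: "(\<Sum>j<n. (if (vs ! i, vs ! j) \<in> parcs G then 1 else 0) * f (vs ! j)) = (\<Sum>w\<in>nbrs G (vs ! i). f w)"
    for i and f :: "'a \<Rightarrow> real"
  proof -
    have "(\<Sum>j<n. (if (vs ! i, vs ! j) \<in> parcs G then 1 else 0) * f (vs ! j))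
      = (\<Sum>w\<in>pverts G. (if (vs ! i, w) \<in> parcs G then 1 else 0) * f w)"
      by (rule sum.reindex_bij_betw[OF bij])
    also have "\<dots> = (\<Sum>w\<in>pverts G. if w \<in> nbrs G (vs ! i) then f w else 0)"
      by (intro sum.cong) (auto simp: nbrs_def)
    also have "\<dots> = (\<Sum>w\<in>nbrs G (vs ! i). f w)"
      using pair_finite_verts nbrs_subset by (simp add: sum.inter_restrict[symmetric] inf.absorb2)
    finally show ?thesis .
  qed
  have ent: "(?A *\<^sub>v v) $ i = (\<Sum>j<n. (if (vs ! i, vs ! j) \<in> parcs G then 1 else 0) * v $ j)"
    if "i < n" "dim_vec v = n" for i v
    using that by (auto simp: adjacency_matrix_wrt_def n_def scalar_prod_def atLeast0LessThan intro!: sum.cong)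
  show ?thesis
  proof
    assume "eigenvalue ?A e"
    then obtain v where v: "v \<in> carrier_vec n" "v \<noteq> 0\<^sub>v n" "?A *\<^sub>v v = e \<cdot>\<^sub>v v"
      by (auto simp: eigenvalue_def eigenvector_def adjacency_matrix_wrt_def n_def)
    define f where "f u = v $ (the_inv_into {..<n} ((!) vs) u)" for u
    have f: "f (vs ! i) = v $ i" if "i < n" for i
      using that bij by (simp add: f_def the_inv_into_f_f bij_betw_def)
    have "\<exists>i<n. v $ i \<noteq> 0"
    proof (rule ccontr)
      assume "\<not> ?thesis"
      then have "v = 0\<^sub>v n" using v(1) by auto
      then show False using v(2) by simp
    qed
    then obtain i where "i < n" "v $ i \<noteq> 0" by (elim exE conjE)
    then have "\<exists>u\<in>pverts G. f u \<noteq> 0" using f nthV by (intro bexI[of _ "vs ! i"]) simp_all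
    moreover have "(\<Sum>w\<in>nbrs G u. f w) = e * f u" if u: "u \<in> pverts G" for u
    proof -
      obtain i where i: "i < n" "u = vs ! i" using idx[OF u] by blast
      have "(\<Sum>w\<in>nbrs G u. f w) = (?A *\<^sub>v v) $ i"
        using i v(1) by (simp add: ent row[symmetric] f)
      then show ?thesis using v(1,3) i f by simp
    qed
    ultimately show "\<exists>f. (\<exists>v\<in>pverts G. f v \<noteq> 0) \<and> (\<forall>v\<in>pverts G. (\<Sum>w\<in>nbrs G v. f w) = e * f v)"
      by (intro exI[of _ f]) simp
  next
    assume "\<exists>f. (\<exists>v\<in>pverts G. f v \<noteq> 0) \<and> (\<forall>v\<in>pverts G. (\<Sum>w\<in>nbrs G v. f w) = e * f v)"
    then obtain f where fu: "\<exists>u\<in>pverts G. f u \<noteq> 0"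
      and f: "\<forall>v\<in>pverts G. (\<Sum>w\<in>nbrs G v. f w) = e * f v" by (elim exE conjE)
    obtain u where u: "u \<in> pverts G" "f u \<noteq> 0" using fu by (elim bexE)
    define v where "v = vec n (\<lambda>i. f (vs ! i))"
    obtain i where i: "i < n" "u = vs ! i" using idx[OF u(1)] by blast
    have "v $ i \<noteq> 0" using i u by (simp add: v_def)
    then have "v \<noteq> 0\<^sub>v n" using i by auto
    moreover have "?A *\<^sub>v v = e \<cdot>\<^sub>v v"
    proof (rule eq_vecI)
      fix i assume "i < dim_vec (e \<cdot>\<^sub>v v)"
      then have i: "i < n" by (simp add: v_def)
      then have "vs ! i \<in> pverts G" by (rule nthV)
      have "(?A *\<^sub>v v) $ i = (\<Sum>j<n. (if (vs ! i, vs ! j) \<in> parcs G then 1 else 0) * f (vs ! j))"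
        using i by (subst ent) (auto simp: v_def intro!: sum.cong)
      also have "\<dots> = e * f (vs ! i)" unfolding row by (rule bspec[OF f]) fact
      finally show "(?A *\<^sub>v v) $ i = (e \<cdot>\<^sub>v v) $ i" using i by (simp add: v_def)
    qed (simp add: adjacency_matrix_wrt_def v_def n_def)
    moreover have "dim_row ?A = n" by (simp add: adjacency_matrix_wrt_def n_def)
    moreover have "v \<in> carrier_vec n" by (simp add: v_def)
    ultimately have "eigenvector ?A v e" unfolding eigenvector_def by simp
    then show "eigenvalue ?A e" unfolding eigenvalue_def by (rule exI)
  qed
qed

text \<open>The eigenfunction puts \<open>m\<close> into the spectrum, and the form inequality
  tested on an eigenfunction for \<open>e\<close> gives \<open>e \<le> m\<close>.\<close>

lemma graph_spectral_radius_eqI: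
  assumes G: "pair_graph G"
    and eig: "\<exists>v\<in>pverts G. f v \<noteq> 0" "\<And>v. v \<in> pverts G \<Longrightarrow> (\<Sum>w\<in>nbrs G v. f w) = m * f v"
    and ray: "\<And>y. (\<Sum>v\<in>pverts G. \<Sum>w\<in>nbrs G v. y v * y w) \<le> m * (\<Sum>v\<in>pverts G. (y v)\<^sup>2)"
  shows "graph_spectral_radius G = m"
proof -
  interpret pair_graph G by fact
  obtain vs where vs: "distinct vs" "set vs = pverts G"
    using finite_distinct_list[OF pair_finite_verts] by (elim exE conjE)
  let ?A = "adjacency_matrix_wrt vs G"
  have "?A \<in> carrier_mat (length vs) (length vs)" by (simp add: adjacency_matrix_wrt_def)
  then have fin: "finite (spectrum ?A)" by (rule card_finite_spectrum)
  have "Max (spectrum ?A) = m"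
  proof (rule Max_eqI[OF fin])
    show "m \<in> spectrum ?A"
      unfolding spectrum_def mem_Collect_eq eigenvalue_adjacency_matrix_wrt_iff[OF vs assms(1)]
      using eig by (intro exI[of _ f]) simp
  next
    fix e assume "e \<in> spectrum ?A"
    then have "eigenvalue ?A e" by (simp add: spectrum_def)
    then obtain g where gu: "\<exists>u\<in>pverts G. g u \<noteq> 0"
      and g: "\<forall>v\<in>pverts G. (\<Sum>w\<in>nbrs G v. g w) = e * g v"
      unfolding eigenvalue_adjacency_matrix_wrt_iff[OF vs assms(1)] by (elim exE conjE)
    obtain u where u: "u \<in> pverts G" "g u \<noteq> 0" using gu by (elim bexE)
    have "e * (\<Sum>v\<in>pverts G. (g v)\<^sup>2) = (\<Sum>v\<in>pverts G. g v * (\<Sum>w\<in>nbrs G v. g w))"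
      using g by (simp add: sum_distrib_left power2_eq_square mult_ac)
    also have "\<dots> \<le> m * (\<Sum>v\<in>pverts G. (g v)\<^sup>2)"
      using ray[of g] by (simp add: sum_distrib_left)
    finally have "e * (\<Sum>v\<in>pverts G. (g v)\<^sup>2) \<le> m * (\<Sum>v\<in>pverts G. (g v)\<^sup>2)" .
    moreover have "0 < (\<Sum>v\<in>pverts G. (g v)\<^sup>2)"
      using u pair_finite_verts by (intro sum_pos2[of _ u]) auto
    ultimately show "e \<le> m" by (rule mult_right_le_imp_le)
  qed
  then show ?thesis unfolding graph_spectral_radius_def spectrum_adjacency_matrix[OF vs] .
qed

lemma exists_perron_eigenfunction:
  assumes G: "pair_graph G" and ne: "pverts G \<noteq> {}"
  obtains x :: "'a \<Rightarrow> real" where "\<And>v. v \<in> pverts G \<Longrightarrow> 0 \<le> x v" "\<exists>v\<in>pverts G. x v \<noteq> 0"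
    "\<And>v. v \<in> pverts G \<Longrightarrow> (\<Sum>w\<in>nbrs G v. x w) = graph_spectral_radius G * x v"
proof -
  interpret pair_graph G by fact
  interpret nbhd "nbrs G" by (rule nbhd_nbrs)
  obtain m and x :: "'a \<Rightarrow> real" where x: "\<forall>v\<in>pverts G. 0 \<le> x v" "\<exists>v\<in>pverts G. x v \<noteq> 0"
    and eig: "\<forall>v\<in>pverts G. (\<Sum>w\<in>nbrs G v. x w) = m * x v"
    and ray: "\<forall>y. (\<Sum>v\<in>pverts G. \<Sum>w\<in>nbrs G v. y v * y w) \<le> m * (\<Sum>v\<in>pverts G. (y v)\<^sup>2)"
    using exists_top_eigenfunction[OF pair_finite_verts ne nbrs_subset] by (elim exE conjE)
  have "graph_spectral_radius G = m"
    by (rule graph_spectral_radius_eqI[OF assms(1) x(2)]) (use eig ray in simp_all)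
  then show thesis using x eig by (intro that[of x]) simp_all
qed

section \<open>The complete split graph\<close>

lemma (in pair_pre_digraph) awalk_verts_zip:
  "cas u (zip (u # ys) (ys @ [v])) v \<and> awalk_verts u (zip (u # ys) (ys @ [v])) = u # ys @ [v]"
  by (induction ys arbitrary: u) auto

lemma set_zip_shift_subset:
  "successively (\<lambda>a b. (a, b) \<in> A) (u # ys @ [v]) \<Longrightarrow> set (zip (u # ys) (ys @ [v])) \<subseteq> A"
  by (induction ys arbitrary: u) auto

lemma (in pair_graph) undirected_cycle_if_cyc:
  assumes "cyc (nbrs G) xs"
  shows "\<exists>p. undirected_cycle G p \<and> cycle_verts p = set xs"
proof -
  obtain u ys where xs: "xs = u # ys" using assms by (cases xs) (auto simp: cyc_def)
  \<comment> \<open>Pairing each vertex with its successor, and the last one with \<open>u\<close>,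
    lists the arcs of the closed walk.\<close>
  define p where "p = zip (u # ys) (ys @ [u])"
  have len: "length p = length xs" by (simp add: p_def xs)
  have "successively (\<lambda>a b. (a, b) \<in> parcs G) (xs @ [u])"
    by (subst successively_append_iff) (use assms in \<open>auto simp: cyc_def nbrs_def xs\<close>)
  then have sub: "set p \<subseteq> parcs G" unfolding p_def by (intro set_zip_shift_subset) (simp add: xs)
  have "(u, hd (ys @ [u])) \<in> set p" unfolding p_def by (cases ys) auto
  then have "u \<in> pverts G" using sub wellformed' by blast
  then have "awalk u p u" using sub awalk_verts_zip[of u ys u] by (simp add: awalk_def p_def)
  moreover have "distinct (tl (awalk_verts u p))"
    using awalk_verts_zip[of u ys u] assms by (simp add: p_def cyc_def xs)
  moreover have "3 \<le> length p" using assms len by (simp add: cyc_def)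
  moreover then have "p \<noteq> []" by auto
  ultimately have "undirected_cycle G p" by (auto simp: undirected_cycle_def cycle_def)
  moreover have "cycle_verts p = set xs"
  proof -
    have "fst ` set p = set (map fst p)" by simp
    also have "map fst p = u # ys" unfolding p_def by (rule map_fst_zip) simp
    finally show ?thesis by (simp add: cycle_verts_def xs)
  qed
  ultimately show ?thesis by blast
qed

text \<open>The inclusion in \<open>X\<close> is carried through the induction: it makes the new
  cycle disjoint from those in \<open>C\<close> and, its vertex set being nonempty, different from
  them.\<close>

lemma (in pair_graph) independent_cycles_if_disjoint_cycles:
  "disjoint_cycles (nbrs G) k X \<Longrightarrow>
    \<exists>C. finite C \<and> card C = k \<and> independent_cycles G C \<and> (\<forall>p\<in>C. cycle_verts p \<subseteq> X)"
proof (induction k arbitrary: X)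
  case 0
  show ?case by (rule exI[of _ "{}"]) (simp add: independent_cycles_def)
next
  case (Suc k)
  then obtain xs where xs: "cyc (nbrs G) xs" "set xs \<subseteq> X" "disjoint_cycles (nbrs G) k (X - set xs)"
    by auto
  obtain p where p: "undirected_cycle G p" "cycle_verts p = set xs"
    using undirected_cycle_if_cyc[OF xs(1)] by blast
  obtain C where C: "finite C" "card C = k" "independent_cycles G C"
    "\<forall>q\<in>C. cycle_verts q \<subseteq> X - set xs" using Suc.IH[OF xs(3)] by blast
  have disj: "disjnt (cycle_verts p) (cycle_verts q)" if "q \<in> C" for q
    using C(4) that p(2) by (auto simp: disjnt_def)
  have "set xs \<noteq> {}" using xs(1) by (auto simp: cyc_def)
  then have "p \<notin> C" using disj[of p] p(2) by (auto simp: disjnt_def)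
  then have "card (insert p C) = Suc k" using C by simp
  moreover have "independent_cycles G (insert p C)"
    using C(3) p(1) disj by (auto simp: independent_cycles_def pairwise_insert disjnt_sym)
  moreover have "\<forall>q\<in>insert p C. cycle_verts q \<subseteq> X" using C(4) p(2) xs(2) by auto
  ultimately show ?case using C(1) by (intro exI[of _ "insert p C"]) simp
qed

text \<open>An intrinsic description of the complete split graph with clique \<open>U\<close>, so
  that \<open>G\<close> and \<open>complete_split_graph\<close> are treated alike without transport
  along an isomorphism.\<close>

definition split_nbrs :: "'a pair_pre_digraph \<Rightarrow> 'a set \<Rightarrow> bool" where
  "split_nbrs G U \<longleftrightarrow> U \<subseteq> pverts G \<and>
     (\<forall>v\<in>pverts G. nbrs G v = (if v \<in> U then pverts G - {v} else U))"

text \<open>The function with value \<open>r\<close> on \<open>U\<close> and \<open>s\<close>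
  elsewhere is an eigenfunction, and \<open>split_form_le\<close> shows that no eigenvalue is
  larger.\<close>

lemma graph_spectral_radius_split:
  assumes G: "pair_graph G" and U: "split_nbrs G U" "card U = s" and n: "card (pverts G) = n"
    and s: "1 \<le> s" "s \<le> n"
    and r: "0 < r" "r\<^sup>2 = (real s - 1) * r + real s * (real n - real s)"
  shows "graph_spectral_radius G = r"
proof -
  interpret pair_graph G by fact
  let ?V = "pverts G"
  define f where "f v = (if v \<in> U then r else real s)" for v
  have UV: "U \<subseteq> ?V" and nb: "\<And>v. v \<in> ?V \<Longrightarrow> nbrs G v = (if v \<in> U then ?V - {v} else U)"
    using U(1) by (auto simp: split_nbrs_def)
  have finU: "finite U" using finite_subset[OF UV pair_finite_verts] .
  have sU: "sum f U = real s * r" using U(2) by (simp add: f_def)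
  have "sum f (?V - U) = real (card (?V - U)) * real s" by (simp add: f_def)
  also have "card (?V - U) = n - s" using finU UV n U(2) by (simp add: card_Diff_subset)
  finally have sV: "sum f ?V = real s * r + (real n - real s) * real s"
    using sum.subset_diff[OF UV pair_finite_verts, of f] sU s by (simp add: of_nat_diff)
  show ?thesis
  proof (rule graph_spectral_radius_eqI[OF G, of f])
    obtain u where "u \<in> U" using s U(2) by fastforce
    then show "\<exists>v\<in>?V. f v \<noteq> 0" using UV r by (intro bexI[of _ u]) (auto simp: f_def)
    show "(\<Sum>w\<in>nbrs G v. f w) = r * f v" if v: "v \<in> ?V" for v
    proof (cases "v \<in> U")
      case True
      then have "(\<Sum>w\<in>nbrs G v. f w) = sum f ?V - r"
        using nb[OF v] v pair_finite_verts by (simp add: sum_diff1 f_def)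
      then show ?thesis using True sV r(2) by (simp add: f_def power2_eq_square algebra_simps)
    next
      case False
      then show ?thesis using nb[OF v] sU by (simp add: f_def)
    qed
    show "(\<Sum>v\<in>?V. \<Sum>w\<in>nbrs G v. y v * y w) \<le> r * (\<Sum>v\<in>?V. (y v)\<^sup>2)" for y
      using split_form_le(1)[OF pair_finite_verts UV U(2) n s r, of y] nb by simp
  qed
qed

lemma split_nbrs_complete_split_graph:
  "s \<le> n \<Longrightarrow> split_nbrs (complete_split_graph n s) {..<s}"
  by (auto simp: split_nbrs_def nbrs_def complete_split_graph_def)

text \<open>An isomorphism yields \<open>U\<close> as the preimage of \<open>{..<s}\<close>.
  Conversely, a bijection of \<open>U\<close> onto \<open>{..<s}\<close> and one of the other
  vertices onto \<open>{s..<n}\<close> combine to an isomorphism.\<close>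

lemma digraph_iso_split_iff:
  assumes G: "pair_graph G" and n: "card (pverts G) = n" and s: "s \<le> n"
  shows "digraph_iso (with_proj G) (with_proj (complete_split_graph n s)) \<longleftrightarrow>
    (\<exists>U. split_nbrs G U \<and> card U = s)"
proof -
  interpret pair_graph G by fact
  let ?V = "pverts G" and ?H = "complete_split_graph n s"
  have "digraph_iso (with_proj G) (with_proj ?H) \<longleftrightarrow>
    (\<exists>f. bij_betw f ?V {..<n} \<and> parcs ?H = map_prod f f ` parcs G)"
    by (subst digraph_iso_with_proj_iff) (use pair_wf_digraph_axioms in \<open>auto simp: complete_split_graph_def\<close>)
  also have "\<dots> \<longleftrightarrow> (\<exists>U. split_nbrs G U \<and> card U = s)"
  proof (intro iffI; elim exE conjE)
    fix f assume f: "bij_betw f ?V {..<n}" and A: "parcs ?H = map_prod f f ` parcs G"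
    have inj: "inj_on f ?V" and im: "f ` ?V = {..<n}" using f by (auto simp: bij_betw_def)
    define U where "U = {v \<in> ?V. f v < s}"
    have arc: "(v, w) \<in> parcs G \<longleftrightarrow> (f v, f w) \<in> parcs ?H" if "v \<in> ?V" "w \<in> ?V" for v w
    proof
      assume "(f v, f w) \<in> parcs ?H"
      then obtain a b where ab: "(a, b) \<in> parcs G" "f v = f a" "f w = f b" unfolding A by auto
      then have "a \<in> ?V" "b \<in> ?V" by (auto dest: wellformed')
      then have "v = a" "w = b" using ab that inj by (auto dest: inj_onD)
      then show "(v, w) \<in> parcs G" using ab by simp
    qed (force simp: A)
    have "f ` U = {..<s}"
    proof
      show "{..<s} \<subseteq> f ` U"
      proof
        fix i assume "i \<in> {..<s}"
        then have "i < s" "i \<in> f ` ?V" using s im by auto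
        then show "i \<in> f ` U" by (auto simp: U_def)
      qed
    qed (auto simp: U_def)
    moreover have "inj_on f U" using inj by (rule inj_on_subset) (auto simp: U_def)
    ultimately have "card U = s" by (metis card_image card_lessThan)
    moreover have "nbrs G v = (if v \<in> U then ?V - {v} else U)" if v: "v \<in> ?V" for v
    proof -
      have "w \<in> nbrs G v \<longleftrightarrow> w \<in> (if v \<in> U then ?V - {v} else U)" if w: "w \<in> ?V" for w
      proof -
        have "f v < n" "f w < n" "f v = f w \<longleftrightarrow> v = w"
          using im v w inj_on_eq_iff[OF inj v w] by auto
        then show ?thesis using arc[OF v w] v w
          by (auto simp: nbrs_def U_def complete_split_graph_def)
      qed
      moreover have "nbrs G v \<subseteq> ?V" "(if v \<in> U then ?V - {v} else U) \<subseteq> ?V"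
        using nbrs_subset by (auto simp: U_def)
      ultimately show ?thesis by blast
    qed
    ultimately show "\<exists>U. split_nbrs G U \<and> card U = s"
      by (intro exI[of _ U]) (auto simp: split_nbrs_def U_def)
  next
    fix U assume U: "split_nbrs G U" "card U = s"
    have UV: "U \<subseteq> ?V" and nb: "\<And>v. v \<in> ?V \<Longrightarrow> nbrs G v = (if v \<in> U then ?V - {v} else U)"
      using U(1) by (auto simp: split_nbrs_def)
    have finU: "finite U" using finite_subset[OF UV pair_finite_verts] .
    obtain g where g: "bij_betw g U {..<s}"
      using finite_same_card_bij[OF finU, of "{..<s}"] U(2) by auto
    have "card (?V - U) = card {s..<n}" using finU UV n U(2) by (simp add: card_Diff_subset)
    then obtain h where h: "bij_betw h (?V - U) {s..<n}"
      using finite_same_card_bij[of "?V - U" "{s..<n}"] pair_finite_verts by auto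
    define f where "f v = (if v \<in> U then g v else h v)" for v
    have "bij_betw f U {..<s}" using g by (rule bij_betw_cong[THEN iffD1, rotated]) (simp add: f_def)
    moreover have "bij_betw f (?V - U) {s..<n}"
      using h by (rule bij_betw_cong[THEN iffD1, rotated]) (simp add: f_def)
    ultimately have "bij_betw f (U \<union> (?V - U)) ({..<s} \<union> {s..<n})"
      by (rule bij_betw_combine) auto
    then have f: "bij_betw f ?V {..<n}" using UV s by (simp add: ivl_disj_un Un_absorb1)
    have inj: "inj_on f ?V" and im: "f ` ?V = {..<n}" using f by (auto simp: bij_betw_def)
    have less: "f v < s \<longleftrightarrow> v \<in> U" if "v \<in> ?V" for v
      using that bij_betwE[OF g] bij_betwE[OF h] by (force simp: f_def)
    have arc: "(v, w) \<in> parcs G \<longleftrightarrow> (f v, f w) \<in> parcs ?H" if v: "v \<in> ?V" and w: "w \<in> ?V" for v w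
    proof -
      have "f v < n" "f w < n" "f v = f w \<longleftrightarrow> v = w"
        using im v w inj_on_eq_iff[OF inj v w] by auto
      moreover have "(v, w) \<in> parcs G \<longleftrightarrow> w \<in> nbrs G v" by (simp add: nbrs_def)
      ultimately show ?thesis unfolding nb[OF v] using v w less
        by (auto simp: complete_split_graph_def)
    qed
    have "parcs ?H = map_prod f f ` parcs G"
    proof
      show "parcs ?H \<subseteq> map_prod f f ` parcs G"
      proof clarify
        fix i j assume ij: "(i, j) \<in> parcs ?H"
        then have "i \<in> f ` ?V" "j \<in> f ` ?V" unfolding im by (auto simp: complete_split_graph_def)
        then obtain v w where "v \<in> ?V" "w \<in> ?V" "i = f v" "j = f w" by blast
        then show "(i, j) \<in> map_prod f f ` parcs G" using arc ij by force
      qed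
      show "map_prod f f ` parcs G \<subseteq> parcs ?H" using arc by (auto dest: wellformed')
    qed
    then show "\<exists>f. bij_betw f ?V {..<n} \<and> parcs ?H = map_prod f f ` parcs G" using f by blast
  qed
  finally show ?thesis .
qed

theorem theorem1p2:
  fixes G :: "'a pair_pre_digraph" and k n :: nat and lam :: real
  assumes "k \<ge> 1"
    and "lam = 1 / (120 * (real k)\<^sup>2)"
    and "real n \<ge> 16 * (2 * real k - 1) / lam\<^sup>2"
    and "pair_graph G"
    and "card (pverts G) = n"
    and "\<not> contains_independent_cycles k G"
  shows "graph_spectral_radius G \<le> graph_spectral_radius (complete_split_graph n (2 * k - 1)) \<and>
    (graph_spectral_radius G = graph_spectral_radius (complete_split_graph n (2 * k - 1)) \<longleftrightarrow>
      digraph_iso (with_proj G) (with_proj (complete_split_graph n (2 * k - 1))))"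
proof -
  interpret pair_graph G by fact
  interpret nbhd "nbrs G" by (rule nbhd_nbrs)
  let ?V = "pverts G"
  define s where "s = 2 * k - 1"
  \<comment> \<open>Closed form of the spectral radius of the complete split graph, the positive
    root of the equation in \<open>r2\<close>.\<close>
  define r where "r = (real s - 1 + sqrt ((real s - 1)\<^sup>2 + 4 * (real s * (real n - real s)))) / 2"
  define th where "th = graph_spectral_radius G"
  have s: "1 \<le> s" "real s = 2 * real k - 1" using assms(1) by (auto simp: s_def of_nat_diff)
  have "lam\<^sup>2 = 1 / (14400 * real k ^ 4)" by (simp add: assms(2) power_divide power_mult_distrib)
  then have nk: "230400 * real k ^ 4 * (2 * real k - 1) \<le> real n"
    using assms(3) by (simp add: algebra_simps)
  have sn: "real s < real n"
  proof -
    have "1 * (2 * real k - 1) < 230400 * real k ^ 4 * (2 * real k - 1)"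
    proof (rule mult_strict_right_mono)
      have "1 \<le> real k ^ 4" using assms(1) by simp
      then show "1 < 230400 * real k ^ 4" by simp
    qed (use assms(1) in simp)
    then show ?thesis using nk s(2) by simp
  qed
  then have sn': "s \<le> n" by simp
  have pos: "0 < real s * (real n - real s)" using s(1) sn by simp
  have r0: "0 < r"
  proof -
    have "0 < sqrt ((real s - 1)\<^sup>2 + 4 * (real s * (real n - real s)))"
      using pos by (intro real_sqrt_gt_zero add_nonneg_pos) auto
    moreover have "0 \<le> real s - 1" using s(1) by simp
    ultimately show ?thesis unfolding r_def by (intro divide_pos_pos add_nonneg_pos) auto
  qed
  have r2: "r\<^sup>2 = (real s - 1) * r + real s * (real n - real s)"
  proof -
    have "2 * r - (real s - 1) = sqrt ((real s - 1)\<^sup>2 + 4 * (real s * (real n - real s)))"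
      by (simp add: r_def field_simps)
    then have "(2 * r - (real s - 1))\<^sup>2 = (real s - 1)\<^sup>2 + 4 * (real s * (real n - real s))"
      using pos by (simp add: add_nonneg_nonneg)
    then show ?thesis by (simp add: power2_eq_square algebra_simps)
  qed
  have gS: "graph_spectral_radius (complete_split_graph n s) = r"
    by (rule graph_spectral_radius_split[OF pair_graph_complete_split_graph
          split_nbrs_complete_split_graph[OF sn'] _ _ s(1) sn' r0 r2])
      (simp_all add: complete_split_graph_def)
  note iso = digraph_iso_split_iff[OF assms(4,5) sn']
  have split_eq: "th = r" if "split_nbrs G U" "card U = s" for U
    unfolding th_def by (rule graph_spectral_radius_split[OF assms(4) that assms(5) s(1) sn' r0 r2])
  \<comment> \<open>Together with \<open>split_eq\<close> this shows that \<open>r \<le> th\<close>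
    forces \<open>th = r\<close>, which rules out \<open>th > r\<close> and settles the equality
    case.\<close>
  have split: "\<exists>U. split_nbrs G U \<and> card U = s" if ge: "r \<le> th"
  proof -
    have "?V \<noteq> {}" using sn assms(5) by auto
    then obtain y where y: "\<And>v. v \<in> ?V \<Longrightarrow> 0 \<le> y v" "\<exists>v\<in>?V. y v \<noteq> 0"
      "\<And>v. v \<in> ?V \<Longrightarrow> (\<Sum>w\<in>nbrs G v. y w) = th * y v"
      using exists_perron_eigenfunction[OF assms(4)] unfolding th_def by metis
    define m where "m = Max (y ` ?V)"
    have "m \<in> y ` ?V" unfolding m_def using \<open>?V \<noteq> {}\<close> by (intro Max_in) auto
    then obtain u0 where u0: "u0 \<in> ?V" "y u0 = m" by auto
    have ym: "y v \<le> m" if "v \<in> ?V" for v using that by (simp add: m_def)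
    obtain v1 where v1: "v1 \<in> ?V" "y v1 \<noteq> 0" using y(2) by blast
    have m0: "0 < m" using y(1)[OF v1(1)] v1(2) ym[OF v1(1)] by simp
    define x where "x v = y v / m" for v
    have x: "0 \<le> x v \<and> x v \<le> 1" if "v \<in> ?V" for v
      using y(1)[OF that] ym[OF that] m0 by (simp add: x_def)
    have eig: "(\<Sum>w\<in>nbrs G v. x w) = th * x v" if "v \<in> ?V" for v
      using y(3)[OF that] by (simp add: x_def sum_divide_distrib[symmetric])
    have no: "\<not> disjoint_cycles (nbrs G) k ?V"
      using independent_cycles_if_disjoint_cycles assms(6)
      unfolding contains_independent_cycles_def by blast
    have th0: "0 < th" using ge r0 by simp
    have "0 \<le> (real s - 1) * r" using s(1) r0 by simp
    then have "real s * (real n - real s) \<le> r\<^sup>2" using r2 by simp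
    also have "\<dots> \<le> th\<^sup>2" using ge r0 by (intro power_mono) auto
    finally have th2: "(2 * real k - 1) * (real n - (2 * real k - 1)) \<le> th\<^sup>2" by (simp only: s(2))
    define U where "U = {v \<in> ?V. 1 - 1 / (4 * real k) \<le> x v}"
    have U: "U \<subseteq> ?V" by (auto simp: U_def)
    have x0: "x u0 = 1" using u0 m0 by (simp add: x_def)
    note hubs = large_eigenvalue_hubs[OF pair_finite_verts nbrs_subset assms(5) no assms(1) nk x
        u0(1) x0 th0 th2 eig, folded U_def]
    \<comment> \<open>\<open>M\<close> is attained off \<open>U\<close>, so it lies below the
      threshold that defines \<open>U\<close>, hence strictly below every entry on
      \<open>U\<close>.\<close>
    define M where "M = Max (x ` (?V - U))"
    have "?V - U \<noteq> {}"
    proof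
      assume "?V - U = {}"
      then have "U = ?V" using U by auto
      then show False using hubs(1) sn assms(5) by (simp add: s_def)
    qed
    then have "M \<in> x ` (?V - U)" unfolding M_def by (intro Max_in) auto
    then obtain v2 where v2: "v2 \<in> ?V - U" "M = x v2" by auto
    have M: "x v \<le> M" if "v \<in> ?V - U" for v using that by (simp add: M_def)
    have MU: "M < x u" if "u \<in> U" for u using v2 that by (auto simp: U_def)
    have "nbrs G v = (if v \<in> U then ?V - {v} else U)" if "v \<in> ?V" for v
      using eq_split_if_large_eigenvalue[OF pair_finite_verts nbrs_subset no assms(1) U hubs(1)
          assms(5) hubs(2) _ M MU eig r0 r2[unfolded s_def] ge that] x by blast
    then have "split_nbrs G U" using U by (simp add: split_nbrs_def)
    then show ?thesis using hubs(1) by (auto simp: s_def)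
  qed
  show ?thesis
    unfolding s_def[symmetric] gS iso th_def[symmetric]
    using split split_eq by (metis linorder_le_cases order_refl)
qed

end
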